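(* Let $0<\delta<1$ and $1/2\le\sigma<1$ be fixed, let $t>1$, let $\lambda_c:=\frac{t^{\delta-1}}{1-t^{\delta-1}}=\frac{1}{t^{1-\delta}-1}$, and let $\lambda$ satisfy $\lambda_c\le\lambda\le t^{1-\delta}-1$. Write $\lambda=\lambda_c(1+\Lambda)$ (so $0\le\Lambda<\frac{t^{1-\delta}-1}{\lambda_c}-1$) and set $$\omega(t,\Lambda):=\sqrt{\frac{\lambda_c t}{2}}\,\frac{\ln(1+\Lambda)}{1+\lambda_c}\ \ (\ge 0).$$ Let $J_B$ and $\widetilde J_B$ be as in the context. Then $$J_B(t;\lambda)=\left(\frac{\lambda_c}{1+\lambda_c}\right)^{1/2}\left(\frac{1}{1+\lambda_c}\right)^{\sigma-1/2}\exp\!\left(\frac{{\rm i} t f_0(\Lambda,\lambda_c)}{1+\lambda_c}\right)\widetilde J_B(t;\Lambda),$$ and, as $t\to\infty$, $$\widetilde J_B(t;\Lambda)={\rm e}^{-{\rm i}\omega^2}\sqrt{\frac{2}{\lambda_c t}}\left(\int_\omega^{\infty{\rm e}^{{\rm i}\pi/4}}{\rm e}^{{\rm i}\xi^2}\,{\rm d}\xi\right)\big(1+o(1)\big),$$ where the $o(1)$ is independent of $\Lambda$. If $\Lambda$ is such that $\omega={\cal O}(1)$ as $t\to\infty$ (e.g. $\Lambda=0$), then the integral $\int_\omega^{\infty{\rm e}^{{\rm i}\pi/4}}{\rm e}^{{\rm i}\xi^2}{\rm d}\xi$ is ${\cal O}(1)$ with implied constant independent of $\Lambda$. If $\Lambda$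 is such that $\omega\to\infty$ as $t\to\infty$, then $$\widetilde J_B(t;\Lambda)=\sqrt{\frac{2}{\lambda_c t}}\left(\frac{-1}{2{\rm i}\omega}+{\cal O}\!\left(\frac{1}{\omega^3}\right)\right)\big(1+o(1)\big)\quad (t\to\infty),$$ where both the $o(1)$ and the implied constant in ${\cal O}(1/\omega^3)$ are independent of $\Lambda$.
   Context: $F(z;\lambda):=(1-z)\ln(1-z)+z\ln z+z\ln\lambda$, with branch cuts $(-\infty,0]$ and $[1,\infty)$. The angle $\phi$ satisfies $0<\phi<\pi/2$ if $\ln\lambda\ge0$ and $0<\phi<\arctan(\pi/|\ln\lambda|)$ if $\ln\lambda<0$ (equivalently, the integrand below decays exponentially at infinity along the ray). $J_B(t;\lambda):=\int_{1-t^{\delta-1}}^{\infty{\rm e}^{{\rm i}\phi}}(1-z)^{-1/2}z^{\sigma-1/2}\exp({\rm i} tF(z;\lambda))\,{\rm d} z$, where $\int_c^{\infty{\rm e}^{{\rm i}\theta}}$ denotes integration from $c$ to infinity along the ray $c+r{\rm e}^{{\rm i}\theta}$, $r\ge0$. Further, $f_0(\Lambda,\lambda_c):=\ln\!\big(\frac{\lambda_c(1+\Lambda)}{1+\lambda_c}\big)-\lambda_c\ln\!\big(\frac{1+\lambda_c}{\lambda_c}\big)$, $g(\zeta;t):=(1-\zeta)^{-1/2}(1+\lambda_c\zeta)^{\sigma-1/2}$, $f_1(\zeta;t,\Lambda):=\lambda_c\zeta[\ln(1+\Lambda)+\ln(1+\lambda_c\zeta)-\ln(1-\zeta)]+\ln(1+\lambda_c\zeta)+\lambda_c\ln(1-\zeta)$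 (branch cut of $\ln(1+\lambda_c\zeta)$ on $(-\infty,-1/\lambda_c]$, of $\ln(1-\zeta)$ on $[1,\infty)$), $h:=f_1/(1+\lambda_c)$, and $\widetilde J_B(t;\Lambda):=\int_0^{\infty{\rm e}^{{\rm i}\phi}}g(\zeta;t)\exp({\rm i} t h(\zeta;t,\Lambda))\,{\rm d}\zeta$ (this corresponds to the substitution $z=(1+\lambda_c\zeta)/(1+\lambda_c)$). *)

theory Defs
  imports "HOL-Analysis.Analysis"
begin

definition ray_integral :: "(complex \<Rightarrow> complex) \<Rightarrow> complex \<Rightarrow> real \<Rightarrow> complex" where
  "ray_integral f c \<theta> = integral {0..} (\<lambda>r::real. f (c + of_real r * cis \<theta>) * cis \<theta>)"

definition lamc :: "real \<Rightarrow> real \<Rightarrow> real" where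
  "lamc \<delta> t = 1 / (t powr (1 - \<delta>) - 1)"

text \<open>F(z;lambda); principal Ln has branch cut (-\<infinity>,0], so Ln(1-z) has cut [1,\<infinity>).\<close>
definition Ffun :: "real \<Rightarrow> complex \<Rightarrow> complex" where
  "Ffun lam z = (1 - z) * Ln (1 - z) + z * Ln z + z * of_real (ln lam)"

definition adm_phi :: "real \<Rightarrow> real \<Rightarrow> bool" where
  "adm_phi lam \<phi> \<longleftrightarrow> 0 < \<phi> \<and>
     (if ln lam \<ge> 0 then \<phi> < pi / 2 else \<phi> < arctan (pi / \<bar>ln lam\<bar>))"

definition J_B :: "real \<Rightarrow> real \<Rightarrow> real \<Rightarrow> real \<Rightarrow> real \<Rightarrow> complex" where
  "J_B \<sigma> \<delta> t lam \<phi> = ray_integral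
     (\<lambda>z. (1 - z) powr (-1/2) * z powr (of_real (\<sigma> - 1/2)) * exp (\<i> * of_real t * Ffun lam z))
     (of_real (1 - t powr (\<delta> - 1))) \<phi>"

definition f0 :: "real \<Rightarrow> real \<Rightarrow> real" where
  "f0 \<Lambda> lc = ln (lc * (1 + \<Lambda>) / (1 + lc)) - lc * ln ((1 + lc) / lc)"

definition gfun :: "real \<Rightarrow> real \<Rightarrow> complex \<Rightarrow> complex" where
  "gfun \<sigma> lc \<zeta> = (1 - \<zeta>) powr (-1/2) * (1 + of_real lc * \<zeta>) powr (of_real (\<sigma> - 1/2))"

definition f1 :: "real \<Rightarrow> real \<Rightarrow> complex \<Rightarrow> complex" where
  "f1 lc \<Lambda> \<zeta> = of_real lc * \<zeta> * (of_real (ln (1 + \<Lambda>)) + Ln (1 + of_real lc * \<zeta>) - Ln (1 - \<zeta>))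
      + Ln (1 + of_real lc * \<zeta>) + of_real lc * Ln (1 - \<zeta>)"

definition hfun :: "real \<Rightarrow> real \<Rightarrow> complex \<Rightarrow> complex" where
  "hfun lc \<Lambda> \<zeta> = f1 lc \<Lambda> \<zeta> / of_real (1 + lc)"

definition Jt_B :: "real \<Rightarrow> real \<Rightarrow> real \<Rightarrow> real \<Rightarrow> real \<Rightarrow> complex" where
  "Jt_B \<sigma> \<delta> t \<Lambda> \<phi> = ray_integral
     (\<lambda>\<zeta>. gfun \<sigma> (lamc \<delta> t) \<zeta> * exp (\<i> * of_real t * hfun (lamc \<delta> t) \<Lambda> \<zeta>)) 0 \<phi>"

definition omega :: "real \<Rightarrow> real \<Rightarrow> real \<Rightarrow> real" where
  "omega \<delta> t \<Lambda> = sqrt (lamc \<delta> t * t / 2) * ln (1 + \<Lambda>) / (1 + lamc \<delta> t)"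

definition fres :: "real \<Rightarrow> complex" where
  "fres w = ray_integral (\<lambda>\<xi>. exp (\<i> * \<xi>\<^sup>2)) (of_real w) (pi / 4)"

end

theory Submission
  imports Defs "HOL-Complex_Analysis.Cauchy_Integral_Theorem" "HOL-Real_Asymp.Real_Asymp"
begin

text \<open>Write \<open>t h = N H\<close> with \<open>N = t \<lambda>\<^sub>c / (1 + \<lambda>\<^sub>c) = t\<^sup>\<delta>\<close> and \<open>L = ln (1 + \<Lambda>)\<close>. Then
  \<open>H' = L + Ln (1 + \<lambda>\<^sub>c \<zeta>) - Ln (1 - \<zeta>)\<close>, so \<open>H\<close> agrees with \<open>L \<zeta> + (1 + \<lambda>\<^sub>c) \<zeta>\<^sup>2 / 2\<close> up to \<open>O(\<zeta>\<^sup>3)\<close>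
  at the origin, uniformly in \<open>L\<close>, and \<open>Im H\<close> increases along horizontal lines in the upper
  half-plane. The ray is therefore deformed to a short segment of direction \<open>\<pi>/4\<close> followed by a
  horizontal half-line. The half-line contributes an exponentially small amount; on the segment the
  quadratic model gives exactly the Fresnel term \<open>G\<close>. All errors are \<open>O(1 / (\<surd>N k))\<close> with
  \<open>k = \<surd>N + N L / \<surd>2\<close>, since the linear part of the phase supplies the damping \<open>exp (- N L r / \<surd>2)\<close>.
  An integration by parts shows \<open>|G| \<ge> c / k\<close>, which turns this into a relative error \<open>O(1 / \<surd>N)\<close>
  that is uniform in \<open>\<Lambda>\<close> and \<open>\<phi>\<close>.\<close>

section \<open>Integrals over half-lines\<close>

text \<open>The angle is arbitrary in a range that itself depends on \<open>\<lambda>\<close>, so no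
  uniform estimate is available on the ray. The broken contour is fixed once and for all: constants
  depending on \<open>\<phi>\<close> enter only where the ray integral is shown to converge and the
  connecting segments at infinity are shown to vanish. Horizontal lines suit the far part because
  \<open>L\<close> is real and drops out of \<open>Im H'\<close>; the growth there depends on the
  height alone, while the dependence on \<open>L\<close> survives in the value of
  \<open>Im H\<close> at the corner. The second obstacle is that a relative error is wanted although
  \<open>\<omega>\<close> may stay at 0 or run to infinity with \<open>t\<close>. The Fresnel term
  itself then shrinks like \<open>1 / \<omega>\<close>, so an absolute bound of order
  \<open>1 / N\<close> does not suffice: every error has to keep the damping that comes from
  \<open>L\<close>, and the oscillatory Fresnel integral has to be bounded from below at the same
  rate.\<close>

lemma exp_dominated_integral:
  fixes f :: "real \<Rightarrow> 'a::euclidean_space"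
  assumes cont: "continuous_on {c..} f"
    and bound: "\<And>r. c \<le> r \<Longrightarrow> norm (f r) \<le> C * exp (- (k * r))" and k: "0 < k"
  shows "f integrable_on {c..}" "norm (integral {c..} f) \<le> C * exp (- (k * c)) / k"
proof -
  have g: "((\<lambda>r. C * exp (- (k * r))) has_integral C * exp (- (k * c)) / k) {c..}"
    using has_integral_mult_right[OF has_integral_exp_minus_to_infinity[OF k, of c], of C] by simp
  show i: "f integrable_on {c..}"
    by (rule measurable_bounded_by_integrable_imp_integrable
        [OF continuous_imp_measurable_on_sets_lebesgue[OF cont] has_integral_integrable[OF g]])
      (use bound in auto)
  show "norm (integral {c..} f) \<le> C * exp (- (k * c)) / k"
    using integral_norm_bound_integral[OF i has_integral_integrable[OF g]] bound integral_unique[OF g]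
    by auto
qed

text \<open>Reading a half-line integral as the value at infinity of a primitive serves twice: it
  gives the boundary terms when integrating by parts, and it turns a change of contour into a
  comparison of two limits of one primitive.\<close>

lemma integral_half_line_limit:
  fixes f :: "real \<Rightarrow> 'a::euclidean_space"
  assumes cont: "continuous_on {c..} f"
    and bound: "\<And>r. c \<le> r \<Longrightarrow> norm (f r) \<le> C * exp (- (k * r))" and k: "0 < k"
    and F: "\<And>r. c \<le> r \<Longrightarrow> (F has_vector_derivative f r) (at r)"
  shows "(F \<longlongrightarrow> F c + integral {c..} f) at_top"
proof -
  have i: "f integrable_on {c..}" using exp_dominated_integral[OF cont bound k] by blast
  have *: "norm (F y - (F c + integral {c..} f)) \<le> C * exp (- (k * y)) / k" if y: "c \<le> y" for y
  proof -
    have h: "(f has_integral F y - F c) {c..y}"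
      by (rule fundamental_theorem_of_calculus[OF y])
        (use F in \<open>auto intro: has_vector_derivative_at_within\<close>)
    have c2: "continuous_on {y..} f" by (rule continuous_on_subset[OF cont]) (use y in auto)
    have t: "f integrable_on {y..}" "norm (integral {y..} f) \<le> C * exp (- (k * y)) / k"
      using exp_dominated_integral[OF c2 _ k, of C] bound y by auto
    have "(f has_integral (F y - F c) + integral {y..} f) ({c..y} \<union> {y..})"
      by (rule has_integral_Un[OF h integrable_integral[OF t(1)]])
        (rule negligible_subset[of "{y}"], auto)
    moreover have "{c..y} \<union> {y..} = {c..}" using y by auto
    ultimately have "integral {c..} f = (F y - F c) + integral {y..} f" by auto
    then have "F y - (F c + integral {c..} f) = - integral {y..} f" by (simp add: algebra_simps)
    then show ?thesis using t(2) by simp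
  qed
  have lim: "((\<lambda>y. C * exp (- (k * y)) / k) \<longlongrightarrow> 0) at_top"
    using k by real_asymp
  have "((\<lambda>y. F y - (F c + integral {c..} f)) \<longlongrightarrow> 0) at_top"
    by (rule Lim_null_comparison[OF _ lim])
      (use * in \<open>auto simp: eventually_at_top_linorder\<close>)
  then show ?thesis using Lim_null by blast
qed

section \<open>Rescaling a half-line\<close>

lemma has_integral_stretch_half_line:
  fixes f :: "real \<Rightarrow> 'a::banach"
  assumes f: "(f has_integral I) {0..}" and m: "0 < m"
  shows "((\<lambda>x. f (m * x)) has_integral I /\<^sub>R m) {0..}"
proof -
  let ?f = "\<lambda>x. if x \<in> {0..} then f x else 0"
  let ?g = "\<lambda>x. if x \<in> {0..} then f (m * x) else 0"
  have g: "?g = (\<lambda>x. ?f (m *\<^sub>R x + 0))" using m by (auto simp: zero_le_mult_iff fun_eq_iff)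
  have a: "?f integrable_on cbox a b" for a b using f unfolding has_integral_alt' by blast
  have h: "(?g has_integral (integral (cbox (m*a) (m*b)) ?f) /\<^sub>R m) (cbox a b)" for a b
  proof -
    have "((\<lambda>x. ?f (m *\<^sub>R x + 0)) has_integral (integral (cbox (m*a) (m*b)) ?f) /\<^sub>R m ^ DIM(real))
        (cbox ((m*a - 0) /\<^sub>R m) ((m*b - 0) /\<^sub>R m))"
      by (rule has_integral_affinity'[OF integrable_integral[OF a] m])
    moreover have "(m*a - 0) /\<^sub>R m = a" "(m*b - 0) /\<^sub>R m = b" using m by auto
    ultimately show ?thesis unfolding g by (simp only: DIM_real power_one_right)
  qed
  show ?thesis unfolding has_integral_alt'
  proof (intro conjI allI impI)
    show "?g integrable_on cbox a b" for a b using h by (rule has_integral_integrable)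
    fix e :: real assume e: "0 < e"
    then have "0 < e * m" using m by simp
    then obtain B where B: "B > 0"
      "\<And>a b. ball 0 B \<subseteq> cbox a b \<Longrightarrow> norm (integral (cbox a b) ?f - I) < e * m"
      using f unfolding has_integral_alt' by meson
    \<comment> \<open>Integrability over an unbounded set is tested on large boxes. A box that
      contains the ball of radius \<open>B / m\<close> is stretched to one that contains the ball of
      radius \<open>B\<close>.\<close>
    show "\<exists>B>0. \<forall>a b. ball 0 B \<subseteq> cbox a b \<longrightarrow> norm (integral (cbox a b) ?g - I /\<^sub>R m) < e"
    proof (intro exI[of _ "B / m"] conjI allI impI)
      show "0 < B / m" using B m by simp
      fix a b :: real assume s: "ball 0 (B / m) \<subseteq> cbox a b"
      have "ball 0 B \<subseteq> cbox (m * a) (m * b)"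
      proof
        fix x :: real assume "x \<in> ball 0 B"
        then have "x / m \<in> ball 0 (B / m)" using m by (simp add: divide_strict_right_mono)
        then have "x / m \<in> cbox a b" using s by blast
        then show "x \<in> cbox (m * a) (m * b)" using m by (simp add: field_simps)
      qed
      then have "norm (integral (cbox (m*a) (m*b)) ?f - I) < e * m" by (rule B(2))
      moreover have "integral (cbox a b) ?g - I /\<^sub>R m = (integral (cbox (m*a) (m*b)) ?f - I) /\<^sub>R m"
        using integral_unique[OF h] by (simp add: algebra_simps)
      moreover have "norm ((integral (cbox (m*a) (m*b)) ?f - I) /\<^sub>R m) =
          norm (integral (cbox (m*a) (m*b)) ?f - I) / m"
        using m by (simp only: norm_scaleR) (simp add: divide_inverse mult.commute)
      ultimately show "norm (integral (cbox a b) ?g - I /\<^sub>R m) < e"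
        using m by (simp only: pos_divide_less_eq)
    qed
  qed
qed

text \<open>Stretching can be undone, so both integrands fail to be integrable together, and then
  both integrals have the default value 0. The substitution in \<open>J_B_eq\<close> thus becomes an
  unconditional identity.\<close>

lemma integral_stretch_half_line:
  fixes f :: "real \<Rightarrow> 'a::banach"
  assumes m: "0 < m"
  shows "integral {0..} (\<lambda>x. f (m * x)) = integral {0..} f /\<^sub>R m"
proof (cases "f integrable_on {0..}")
  case True
  then show ?thesis
    using has_integral_stretch_half_line[OF integrable_integral m] by blast
next
  case False
  have "\<not> (\<lambda>x. f (m * x)) integrable_on {0..}"
  proof
    assume "(\<lambda>x. f (m * x)) integrable_on {0..}"
    from has_integral_stretch_half_line[OF integrable_integral[OF this], of "1/m"] m
    have "f integrable_on {0..}" by (auto simp: has_integral_integrable)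
    then show False using False by simp
  qed
  then show ?thesis using False by (simp add: not_integrable_integral)
qed

section \<open>The Fresnel integral\<close>

text \<open>On the line of direction \<open>pi / 4\<close> through \<open>w\<close> the oscillating
  factor \<open>exp (\<i> * \<xi>\<^sup>2)\<close> becomes a Gaussian times an exponential of
  complex rate; \<open>fres_eq_gint\<close> identifies the rate as
  \<open>\<beta> = (1 - \<i>) * sqrt 2 * w\<close>.\<close>

definition gexp :: "complex \<Rightarrow> real \<Rightarrow> complex" where
  "gexp \<beta> r = exp (- of_real (r\<^sup>2) - \<beta> * of_real r)"

definition gint :: "complex \<Rightarrow> complex" where
  "gint \<beta> = integral {0..} (gexp \<beta>)"

lemma norm_gexp: "norm (gexp \<beta> r) = exp (- r\<^sup>2 - Re \<beta> * r)"
  by (simp add: gexp_def)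

lemma continuous_on_gexp [continuous_intros]: "continuous_on S (gexp \<beta>)"
  unfolding gexp_def by (intro continuous_intros)

lemma norm_gexp_le:
  assumes "0 \<le> Re \<beta>" "0 \<le> r"
  shows "norm (gexp \<beta> r) \<le> exp (1/4) * exp (- (1 * r))"
proof -
  have "0 \<le> (r - 1/2)\<^sup>2" "0 \<le> Re \<beta> * r" using assms by auto
  then have "- r\<^sup>2 - Re \<beta> * r \<le> 1/4 - r" by (simp add: power2_eq_square algebra_simps)
  then show ?thesis unfolding norm_gexp by (simp flip: exp_add)
qed

lemma integrable_gexp: "0 \<le> Re \<beta> \<Longrightarrow> gexp \<beta> integrable_on {0..}"
  by (rule exp_dominated_integral[OF continuous_on_gexp norm_gexp_le]) auto

text \<open>The bound is the same for all rates with nonnegative real part. This is what makes the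
  implied constant for bounded \<open>\<omega>\<close> independent of
  \<open>\<Lambda>\<close>.\<close>

lemma norm_gint_le:
  assumes "0 \<le> Re \<beta>"
  shows "norm (gint \<beta>) \<le> exp (1/4)"
  using exp_dominated_integral(2)[OF continuous_on_gexp norm_gexp_le[OF assms], of 0] by (simp add: gint_def)

lemma fres_eq_gint:
  "fres w = exp (\<i> * of_real (w\<^sup>2)) * cis (pi / 4) * gint ((1 - \<i>) * of_real (sqrt 2 * w))"
proof -
  have s: "of_real (sqrt 2) * of_real (sqrt 2) = (2::complex)"
    by (simp flip: of_real_mult)
  have c: "cis (pi / 4) = (1 + \<i>) * of_real (sqrt 2) / 2"
    by (auto simp: complex_eq_iff cos_45 sin_45)
  have "\<i> * (of_real w + of_real r * cis (pi / 4))\<^sup>2 =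
     \<i> * of_real (w\<^sup>2) + (- of_real (r\<^sup>2) - ((1 - \<i>) * of_real (sqrt 2 * w)) * of_real r)" for r
    unfolding c using s by (simp add: field_simps power2_eq_square)
  then have "(\<lambda>r. exp (\<i> * (of_real w + of_real r * cis (pi / 4))\<^sup>2) * cis (pi / 4)) =
    (\<lambda>r. (exp (\<i> * of_real (w\<^sup>2)) * cis (pi / 4)) * gexp ((1 - \<i>) * of_real (sqrt 2 * w)) r)"
    by (simp add: gexp_def exp_add fun_eq_iff)
  then show ?thesis by (simp add: fres_def ray_integral_def gint_def)
qed

text \<open>Integrates \<open>(2 * r + \<beta>) * gexp \<beta> r\<close>, the derivative of
  \<open>- gexp \<beta>\<close>, whose boundary value at 0 produces the 1. The lower bound for
  \<open>gint\<close> and its expansion for large rates both rest on this identity.\<close>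

lemma gint_by_parts:
  assumes b: "0 \<le> Re \<beta>"
  shows "(\<lambda>r. of_real (2 * r) * gexp \<beta> r) integrable_on {0..}"
    "\<beta> * gint \<beta> = 1 - integral {0..} (\<lambda>r. of_real (2 * r) * gexp \<beta> r)"
proof -
  let ?f = "\<lambda>r. of_real (2 * r) * gexp \<beta> r + \<beta> * gexp \<beta> r"
  have c: "continuous_on {0..} (\<lambda>r. of_real (2 * r) * gexp \<beta> r)" by (intro continuous_intros)
  have bd: "norm (of_real (2 * r) * gexp \<beta> r) \<le> (2 * exp 1) * exp (- (1 * r))" if r: "0 \<le> r" for r
  proof -
    have "0 \<le> (r - 1)\<^sup>2" "0 \<le> Re \<beta> * r" using r b by auto
    then have "- r\<^sup>2 - Re \<beta> * r \<le> 1 - 2 * r" by (simp add: power2_eq_square algebra_simps)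
    then have "norm (gexp \<beta> r) \<le> exp 1 * exp (- r) * exp (- r)" unfolding norm_gexp
      by (simp flip: exp_add)
    moreover have re: "r * exp (- r) \<le> 1"
    proof -
      have "r \<le> exp r" using exp_ge_add_one_self[of r] by linarith
      then show ?thesis by (simp add: exp_minus field_simps)
    qed
    ultimately have "r * norm (gexp \<beta> r) \<le> (r * exp (- r)) * (exp 1 * exp (- r))"
      using r by (smt (verit) mult.assoc mult.commute mult_left_mono)
    also have "\<dots> \<le> 1 * (exp 1 * exp (- r))"
      by (rule mult_right_mono) (use re in auto)
    finally show ?thesis using r by (simp add: norm_mult)
  qed
  show i: "(\<lambda>r. of_real (2 * r) * gexp \<beta> r) integrable_on {0..}"
    by (rule exp_dominated_integral[OF c bd]) auto
  have ig: "gexp \<beta> integrable_on {0..}" by (rule integrable_gexp[OF b])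
  have c2: "continuous_on {0..} ?f" by (intro continuous_intros)
  have bd2: "norm (?f r) \<le> (2 * exp 1 + norm \<beta> * exp (1/4)) * exp (- (1 * r))"
    if r: "0 \<le> r" for r
  proof -
    have "norm (?f r) \<le> norm (of_real (2 * r) * gexp \<beta> r) + norm \<beta> * norm (gexp \<beta> r)"
      by (metis norm_mult norm_triangle_ineq)
    also have "\<dots> \<le> (2 * exp 1) * exp (- (1 * r)) + norm \<beta> * (exp (1/4) * exp (- (1 * r)))"
      by (intro add_mono mult_left_mono bd norm_gexp_le) (use r b in auto)
    finally show ?thesis by (simp add: algebra_simps)
  qed
  have d: "((\<lambda>r. - gexp \<beta> r) has_vector_derivative ?f r) (at r)" for r
  proof -
    have *: "((\<lambda>z. - exp (- z\<^sup>2 - \<beta> * z)) has_field_derivative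
        (of_real (2 * r) * gexp \<beta> r + \<beta> * gexp \<beta> r)) (at (of_real r))"
      by (rule derivative_eq_intros refl | simp add: gexp_def)+ (simp add: algebra_simps)
    show ?thesis using has_vector_derivative_real_field[OF *]
      by (simp add: o_def gexp_def)
  qed
  have "((\<lambda>r. - gexp \<beta> r) \<longlongrightarrow> - gexp \<beta> 0 + integral {0..} ?f) at_top"
    by (rule integral_half_line_limit[OF c2 bd2]) (use d in auto)
  moreover have "((\<lambda>r. - gexp \<beta> r) \<longlongrightarrow> 0) at_top"
  proof (rule Lim_null_comparison)
    show "\<forall>\<^sub>F r in at_top. norm (- gexp \<beta> r) \<le> exp (1/4) * exp (- (1 * r))"
      using norm_gexp_le[OF b] by (auto simp: eventually_at_top_linorder intro!: exI[of _ 0])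
    show "((\<lambda>r::real. exp (1/4) * exp (- (1 * r))) \<longlongrightarrow> 0) at_top" by real_asymp
  qed
  ultimately have "- gexp \<beta> 0 + integral {0..} ?f = 0"
    using tendsto_unique[OF trivial_limit_at_top_linorder] by blast
  moreover have "integral {0..} ?f = integral {0..} (\<lambda>r. of_real (2 * r) * gexp \<beta> r) + \<beta> * gint \<beta>"
    using integral_add[OF i integrable_on_mult_right[OF ig, of \<beta>]]
    by (simp add: gint_def)
  moreover have "gexp \<beta> 0 = 1" by (simp add: gexp_def)
  ultimately show "\<beta> * gint \<beta> = 1 - integral {0..} (\<lambda>r. of_real (2 * r) * gexp \<beta> r)"
    by (simp add: algebra_simps add_eq_0_iff)
qed

section \<open>Lower bound and expansion of the Fresnel integral\<close>

definition rint :: "real \<Rightarrow> real" where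
  "rint b = integral {0..} (\<lambda>r. exp (- r\<^sup>2 - b * r))"

lemma gexp_of_real: "gexp (of_real b) r = of_real (exp (- r\<^sup>2 - b * r))"
  unfolding gexp_def exp_of_real[symmetric] by simp

lemma has_integral_rint:
  assumes b: "0 \<le> b"
  shows "((\<lambda>r. exp (- r\<^sup>2 - b * r)) has_integral rint b) {0..}"
    "((\<lambda>r. 2 * r * exp (- r\<^sup>2 - b * r)) has_integral 1 - b * rint b) {0..}"
proof -
  have "((\<lambda>r. Re (gexp (of_real b) r)) has_integral Re (gint (of_real b))) {0..}"
    using has_integral_Re[OF integrable_integral[OF integrable_gexp[of "of_real b"]]] b
    by (simp add: gint_def)
  then have h: "((\<lambda>r. exp (- r\<^sup>2 - b * r)) has_integral Re (gint (of_real b))) {0..}"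
    unfolding gexp_of_real by simp
  then have e: "rint b = Re (gint (of_real b))" unfolding rint_def by blast
  show "((\<lambda>r. exp (- r\<^sup>2 - b * r)) has_integral rint b) {0..}" using h e by simp
  have "((\<lambda>r. Re (of_real (2 * r) * gexp (of_real b) r)) has_integral
      Re (integral {0..} (\<lambda>r. of_real (2 * r) * gexp (of_real b) r))) {0..}"
    using has_integral_Re[OF integrable_integral[OF gint_by_parts(1)[of "of_real b"]]] b by simp
  moreover have "Re (integral {0..} (\<lambda>r. of_real (2 * r) * gexp (of_real b) r)) = 1 - b * rint b"
    using arg_cong[OF gint_by_parts(2)[of "of_real b"], of Re] b e by simp
  ultimately show "((\<lambda>r. 2 * r * exp (- r\<^sup>2 - b * r)) has_integral 1 - b * rint b) {0..}"
    unfolding gexp_of_real by simp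
qed

text \<open>On the initial interval of length \<open>1 / (1 + b)\<close> both
  \<open>r\<^sup>2\<close> and \<open>b * r\<close> are at most 1, so the integrand is at least
  \<open>exp (-2)\<close> there.\<close>

lemma rint_ge:
  assumes b: "0 \<le> b"
  shows "exp (-2) / (1 + b) \<le> rint b"
proof -
  let ?c = "1 / (1 + b)"
  have c: "0 < ?c" "?c \<le> 1" "b * ?c \<le> 1" using b by (auto simp: field_simps)
  have i: "((\<lambda>r. exp (-2)) has_integral ?c * exp (-2)) {0..?c}"
    using has_integral_const_real[of "exp (-2)::real" 0 ?c] c by simp
  have "?c * exp (-2) \<le> rint b"
  proof -
    have s: "(\<lambda>r. exp (- r\<^sup>2 - b * r)) integrable_on {0..?c}"
      by (intro integrable_continuous_interval continuous_intros)
    have "?c * exp (-2) \<le> integral {0..?c} (\<lambda>r. exp (- r\<^sup>2 - b * r))"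
    proof (rule has_integral_le[OF i integrable_integral[OF s]])
      fix r :: real assume r: "r \<in> {0..?c}"
      then have "0 \<le> r" "r \<le> ?c" by auto
      then have "0 \<le> r" "r \<le> 1" using c(2) by linarith+
      then have "r * r \<le> 1 * 1" by (intro mult_mono) auto
      moreover have "b * r \<le> b * ?c" by (rule mult_left_mono) (use r b in auto)
      ultimately have "r * r + b * r \<le> 2" using c(3) by linarith
      then have "-2 \<le> - r\<^sup>2 - b * r" by (simp add: power2_eq_square)
      then show "exp (-2) \<le> exp (- r\<^sup>2 - b * r)" by simp
    qed
    also have "\<dots> \<le> rint b" unfolding rint_def
      by (rule integral_subset_le[OF _ s has_integral_integrable[OF has_integral_rint(1)[OF b]]]) auto
    finally show ?thesis .
  qed
  then show ?thesis by simp
qed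

lemma norm_one_minus_ii: "norm (1 - \<i>) = sqrt 2"
  by (simp add: cmod_def)

text \<open>The modulus of \<open>gexp \<beta>\<close> depends only on \<open>Re \<beta>\<close>, so
  the remainder of the integration by parts with complex rate is dominated by the one with real rate
  \<open>b\<close>, which \<open>has_integral_rint\<close> evaluates.\<close>

lemma gint_expansion:
  assumes b: "0 \<le> b"
  shows "norm ((1 - \<i>) * of_real b * gint ((1 - \<i>) * of_real b) - 1) \<le> 1 - b * rint b"
proof -
  let ?\<beta> = "(1 - \<i>) * of_real b"
  have r: "0 \<le> Re ?\<beta>" using b by simp
  have "norm (integral {0..} (\<lambda>r. of_real (2 * r) * gexp ?\<beta> r)) \<le> integral {0..} (\<lambda>r. 2 * r * exp (- r\<^sup>2 - b * r))"
    by (rule integral_norm_bound_integral[OF gint_by_parts(1)[OF r] has_integral_integrable[OF has_integral_rint(2)[OF b]]])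
      (simp add: norm_mult norm_gexp)
  then show ?thesis
    using gint_by_parts(2)[OF r] integral_unique[OF has_integral_rint(2)[OF b]]
    by (simp add: mult.assoc)
qed

text \<open>Oscillation prevents a direct lower bound. Instead the remainder in
  \<open>gint_expansion\<close> falls short of 1 by exactly \<open>b * rint b\<close>, so
  \<open>\<beta> * gint \<beta>\<close> has at least that modulus, and
  \<open>|\<beta>| = sqrt 2 * b\<close> is divided out. At \<open>b = 0\<close>, where this division
  fails, the integrand is real and positive.\<close>

lemma norm_gint_ge:
  assumes b: "0 \<le> b"
  shows "rint b / sqrt 2 \<le> norm (gint ((1 - \<i>) * of_real b))"
proof (cases "b = 0")
  case True
  have "norm (gint 0) \<ge> Re (gint 0)" by (rule complex_Re_le_cmod)
  moreover have "Re (gint 0) = rint 0"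
  proof -
    have "gint (of_real 0) = of_real (rint 0)"
      unfolding gint_def gexp_of_real
      by (rule integral_unique has_integral_of_real has_integral_rint order_refl)+
    then show ?thesis by simp
  qed
  moreover have "0 \<le> rint 0" unfolding rint_def by (rule integral_nonneg) (use has_integral_rint(1)[of 0] in auto)
  then have "rint 0 / sqrt 2 \<le> rint 0 / 1" by (intro divide_left_mono) auto
  ultimately show ?thesis using True by simp
next
  case False
  have "1 - norm ((1 - \<i>) * of_real b * gint ((1 - \<i>) * of_real b)) \<le> 1 - b * rint b"
    using gint_expansion[OF b] by (smt (verit) norm_minus_commute norm_one norm_triangle_ineq2)
  then have "b * rint b \<le> b * (sqrt 2 * norm (gint ((1 - \<i>) * of_real b)))"
    using b by (simp add: norm_mult norm_one_minus_ii mult_ac)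
  then show ?thesis using b False by (simp add: field_simps)
qed

text \<open>The remainder \<open>1 - b * rint b\<close> is the integral of
  \<open>2 * r * exp (- r\<^sup>2 - b * r)\<close>. Dropping the Gaussian and spending half of the
  linear damping on the factor \<open>r\<close> bounds it by \<open>8 / b\<^sup>2\<close>; division
  by \<open>\<beta>\<close> supplies the third power.\<close>

lemma gint_asymp:
  assumes b: "0 < b"
  shows "norm (gint ((1 - \<i>) * of_real b) - 1 / ((1 - \<i>) * of_real b)) \<le> 8 / b ^ 3"
proof -
  let ?\<beta> = "(1 - \<i>) * complex_of_real b"
  have "1 - b * rint b \<le> 4 / b * (1 / (b / 2))"
  proof (rule has_integral_le[OF has_integral_rint(2)])
    show "((\<lambda>r. 4 / b * exp (- (b / 2) * r)) has_integral 4 / b * (1 / (b / 2))) {0..}"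
      using has_integral_mult_right[OF has_integral_exp_minus_to_infinity[of "b/2" 0], of "4/b"] b by simp
    fix r :: real assume "r \<in> {0..}"
    then have r: "0 \<le> r" by simp
    have "b * r / 2 \<le> exp (b * r / 2)" using exp_ge_add_one_self[of "b * r / 2"] by linarith
    then have "2 * r * exp (- b * r) \<le> (4 / b * exp (b * r / 2)) * exp (- b * r)"
      by (intro mult_right_mono) (use b in \<open>auto simp: field_simps\<close>)
    also have "\<dots> = 4 / b * exp (- (b / 2) * r)" by (simp add: algebra_simps flip: exp_add)
    finally have *: "2 * r * exp (- b * r) \<le> 4 / b * exp (- (b / 2) * r)" .
    have "2 * r * exp (- r\<^sup>2 - b * r) \<le> 2 * r * exp (- b * r)"
      by (rule mult_left_mono) (use r in auto)
    then show "2 * r * exp (- r\<^sup>2 - b * r) \<le> 4 / b * exp (- (b / 2) * r)" using * by linarith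
  qed (use b in auto)
  then have q: "norm (?\<beta> * gint ?\<beta> - 1) \<le> 8 / b\<^sup>2"
    using gint_expansion[of b] b by (simp add: power2_eq_square)
  have n: "b \<le> norm ?\<beta>" using b by (simp add: norm_mult norm_one_minus_ii)
  have z: "?\<beta> \<noteq> 0" using n b by auto
  have "gint ?\<beta> - 1 / ?\<beta> = (?\<beta> * gint ?\<beta> - 1) / ?\<beta>" using z by (simp add: diff_divide_distrib)
  then have "norm (gint ?\<beta> - 1 / ?\<beta>) = norm (?\<beta> * gint ?\<beta> - 1) / norm ?\<beta>" by (simp only: norm_divide)
  also have "\<dots> \<le> (8 / b\<^sup>2) / b" by (rule frac_le) (use q n b in auto)
  finally show ?thesis by (simp add: power2_eq_square power3_eq_cube)
qed

section \<open>The phase function\<close>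

lemma has_vector_derivative_ray:
  fixes G :: "complex \<Rightarrow> complex"
  assumes "(G has_field_derivative G') (at (c + of_real r * d))"
  shows "((\<lambda>r. G (c + of_real r * d)) has_vector_derivative G' * d) (at r)"
proof -
  have "((\<lambda>r. c + of_real r * d) has_vector_derivative d) (at r)"
    by (auto intro!: derivative_eq_intros simp: has_vector_derivative_def scaleR_conv_of_real)
  from field_vector_diff_chain_at[OF this assms] show ?thesis by (simp add: o_def mult.commute)
qed

lemma has_real_derivative_Im_ray:
  fixes G :: "complex \<Rightarrow> complex"
  assumes "(G has_field_derivative G') (at (c + of_real r * d))"
  shows "((\<lambda>r. Im (G (c + of_real r * d))) has_real_derivative Im (G' * d)) (at r)"
  unfolding has_real_derivative_iff_has_vector_derivative
  by (rule bounded_linear.has_vector_derivative[OF bounded_linear_Im has_vector_derivative_ray[OF assms]])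

lemma Im_Ln_neg: "Im w < 0 \<Longrightarrow> Im (Ln w) < 0"
  using Im_Ln_pos_le[of w] Im_Ln_le_pi[of w] by (cases "w = 0") force+

text \<open>The point \<open>1 - z\<close> lies in the quadrant to the left of and below
  \<open>1 - \<i> * \<eta>\<close>, where the argument closest to 0 is that of the corner. If its
  real part is not positive, the argument is at most \<open>- pi / 2\<close> anyway.\<close>

lemma Im_Ln_one_minus_le:
  assumes x: "0 \<le> Re z" and y: "\<eta> \<le> Im z" and \<eta>: "0 < \<eta>"
  shows "Im (Ln (1 - z)) \<le> - arctan \<eta>"
proof -
  let ?w = "1 - z"
  have neg: "Im (Ln ?w) < 0" by (rule Im_Ln_neg) (use y \<eta> in auto)
  have w0: "?w \<noteq> 0" using y \<eta> by (auto simp: complex_eq_iff)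
  show ?thesis
  proof (cases "0 < Re ?w")
    case True
    then have "Im (Ln ?w) = arctan (Im ?w / Re ?w)"
      using arg_conv_arctan[OF True] Arg_eq_Im_Ln[OF w0] by simp
    also have "Im ?w / Re ?w \<le> - \<eta>"
    proof -
      have "\<eta> * Re ?w \<le> \<eta> * 1" by (rule mult_left_mono) (use x \<eta> in auto)
      then have "\<eta> * Re ?w \<le> Im z" using y by linarith
      then have "\<eta> \<le> Im z / Re ?w" using True by (simp only: pos_le_divide_eq)
      then show ?thesis by simp
    qed
    then have "arctan (Im ?w / Re ?w) \<le> arctan (- \<eta>)" by (rule arctan_monotone')
    finally show ?thesis by (simp add: arctan_minus)
  next
    case False
    then have "pi / 2 \<le> \<bar>Im (Ln ?w)\<bar>" using Re_Ln_pos_lt[OF w0] by linarith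
    then show ?thesis using neg arctan_ubound[of \<eta>] by linarith
  qed
qed

text \<open>This is \<open>f1 lc \<Lambda> z / lc\<close> with
  \<open>L = ln (1 + \<Lambda>)\<close>, regrouped into two terms of the form
  \<open>w * Ln w\<close> so that the constants arising from their derivatives cancel.\<close>

definition phase :: "real \<Rightarrow> real \<Rightarrow> complex \<Rightarrow> complex" where
  "phase lc L z = of_real L * z + (1 - z) * Ln (1 - z) + (1 + of_real lc * z) * Ln (1 + of_real lc * z) / of_real lc"

definition phase' :: "real \<Rightarrow> real \<Rightarrow> complex \<Rightarrow> complex" where
  "phase' lc L z = of_real L + Ln (1 + of_real lc * z) - Ln (1 - z)"

definition slit :: "real \<Rightarrow> complex set" where
  "slit lc = {z. 1 - z \<notin> \<real>\<^sub>\<le>\<^sub>0 \<and> 1 + of_real lc * z \<notin> \<real>\<^sub>\<le>\<^sub>0}"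

definition integrand :: "real \<Rightarrow> real \<Rightarrow> real \<Rightarrow> real \<Rightarrow> complex \<Rightarrow> complex" where
  "integrand \<sigma> lc L N z = gfun \<sigma> lc z * exp (\<i> * of_real N * phase lc L z)"

lemma open_slit: "open (slit lc)"
proof -
  have "open ((\<lambda>z. 1 - z) -` (- \<real>\<^sub>\<le>\<^sub>0) \<inter> (\<lambda>z::complex. 1 + of_real lc * z) -` (- \<real>\<^sub>\<le>\<^sub>0))"
    by (intro open_Int open_vimage continuous_intros) (auto simp: open_Compl)
  then show ?thesis by (simp add: slit_def vimage_def Int_def)
qed

lemma slit_upper: "0 < Im z \<Longrightarrow> 0 < lc \<Longrightarrow> z \<in> slit lc"
  by (auto simp: slit_def complex_nonpos_Reals_iff)

lemma zero_in_slit: "0 \<in> slit lc"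
  by (simp add: slit_def)

text \<open>Both cuts run radially away from 0, so segments from 0 to points off the cuts avoid
  them. The integrand therefore has one primitive on the whole cut plane, which serves every contour
  below.\<close>

lemma starlike_slit:
  assumes lc: "0 < lc" shows "starlike (slit lc)"
proof -
  have "z \<in> slit lc" if x: "x \<in> slit lc" and z: "z \<in> closed_segment 0 x" for x z
  proof -
    obtain u where u: "0 \<le> u" "u \<le> 1" "z = of_real u * x"
      using z by (auto simp: closed_segment_def scaleR_conv_of_real)
    have m: "u * s < 1" if "s < 1" for s :: real
      using u that by (smt (verit) mult_left_le_one_le mult_nonneg_nonpos mult_nonneg_nonneg)
    have "u * Re x < 1" if "Im x = 0" using x that m by (auto simp: slit_def complex_nonpos_Reals_iff)
    moreover have "u * (- lc * Re x) < 1" if "Im x = 0"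
      by (rule m) (use x that in \<open>auto simp: slit_def complex_nonpos_Reals_iff\<close>)
    ultimately show ?thesis
      using u lc by (cases "u = 0") (auto simp: slit_def complex_nonpos_Reals_iff algebra_simps)
  qed
  then show ?thesis using zero_in_slit unfolding starlike_def by blast
qed

lemma phase_has_field_derivative:
  assumes "z \<in> slit lc" "0 < lc"
  shows "(phase lc L has_field_derivative phase' lc L z) (at z)"
proof -
  have n: "1 - z \<noteq> 0" "1 + of_real lc * z \<noteq> 0" "1 - z \<notin> \<real>\<^sub>\<le>\<^sub>0" "1 + of_real lc * z \<notin> \<real>\<^sub>\<le>\<^sub>0"
    using assms by (auto simp: slit_def)
  have l: "((\<lambda>z. 1 - z) has_field_derivative - 1) (at z)"
    "((\<lambda>z. 1 + of_real lc * z) has_field_derivative of_real lc) (at z)"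
    by (auto intro!: derivative_eq_intros)
  have 1: "((\<lambda>z. (1 - z) * Ln (1 - z)) has_field_derivative - Ln (1 - z) - 1) (at z)"
    by (rule DERIV_cong[OF DERIV_mult[OF l(1) DERIV_chain2[OF has_field_derivative_Ln[OF n(3)] l(1)]]])
      (use n in \<open>simp add: divide_inverse mult.commute\<close>)
  have 2: "((\<lambda>z. (1 + of_real lc * z) * Ln (1 + of_real lc * z)) has_field_derivative
      of_real lc * (Ln (1 + of_real lc * z) + 1)) (at z)"
    by (rule DERIV_cong[OF DERIV_mult[OF l(2) DERIV_chain2[OF has_field_derivative_Ln[OF n(4)] l(2)]]])
      (use n(2) in \<open>simp add: divide_simps, simp add: algebra_simps\<close>)
  have 3: "((\<lambda>z. of_real L * z) has_field_derivative of_real L) (at z)"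
    by (rule DERIV_cong[OF DERIV_cmult[OF DERIV_ident]]) simp
  show ?thesis unfolding phase_def[abs_def] phase'_def
    by (rule DERIV_cong[OF DERIV_add[OF DERIV_add[OF 3 1] DERIV_cdivide[OF 2]]])
      (use assms in simp)
qed

lemma integrand_differentiable:
  assumes "z \<in> slit lc" "0 < lc"
  shows "integrand \<sigma> lc L N field_differentiable at z"
proof -
  have g: "\<exists>g'. (gfun \<sigma> lc has_field_derivative g') (at z)"
  proof -
    have "1 - z \<notin> \<real>\<^sub>\<le>\<^sub>0" "1 + of_real lc * z \<notin> \<real>\<^sub>\<le>\<^sub>0" using assms by (auto simp: slit_def)
    note d = this[THEN has_field_derivative_powr]
    have "((\<lambda>z. 1 - z) has_field_derivative - 1) (at z)"
      "((\<lambda>z. 1 + of_real lc * z) has_field_derivative of_real lc) (at z)"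
      by (auto intro!: derivative_eq_intros)
    note d' = DERIV_chain2[OF d(1) this(1)] DERIV_chain2[OF d(2) this(2)]
    show ?thesis using DERIV_mult[OF d'] unfolding gfun_def[abs_def] by blast
  qed
  then obtain g' where "(gfun \<sigma> lc has_field_derivative g') (at z)" ..
  from DERIV_mult[OF this DERIV_chain2[OF DERIV_exp DERIV_cmult[OF phase_has_field_derivative[OF assms]]]]
  show ?thesis unfolding integrand_def[abs_def] field_differentiable_def by blast
qed

lemma integrand_primitive:
  assumes "0 < lc"
  obtains P where "\<And>z. z \<in> slit lc \<Longrightarrow> (P has_field_derivative integrand \<sigma> lc L N z) (at z)"
proof -
  have c: "continuous_on (slit lc) (integrand \<sigma> lc L N)"
    by (intro continuous_at_imp_continuous_on ballI field_differentiable_imp_continuous_at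
        integrand_differentiable assms)
  show ?thesis
    using holomorphic_starlike_primitive[OF c starlike_slit[OF assms] open_slit finite.emptyI]
      integrand_differentiable[OF _ assms] that by blast
qed

text \<open>The derivative along the line is \<open>Im (phase' lc L z)\<close>, that is, the
  argument of \<open>1 + lc * z\<close>, which is nonnegative, minus the argument of
  \<open>1 - z\<close>, which is at most \<open>- arctan \<eta>\<close>. The real number
  \<open>L\<close> does not contribute, so the rate is uniform in \<open>\<Lambda>\<close>.\<close>

lemma phase_horizontal:
  assumes lc: "0 < lc" and a: "0 \<le> Re a" "\<eta> \<le> Im a" and \<eta>: "0 < \<eta>" and x: "0 \<le> x"
  shows "Im (phase lc L a) + arctan \<eta> * x \<le> Im (phase lc L (a + of_real x))"
proof -
  let ?u = "\<lambda>x. Im (phase lc L (a + of_real x * 1)) - arctan \<eta> * x"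
  have "?u 0 \<le> ?u x"
  proof (rule DERIV_nonneg_imp_nondecreasing[OF x])
    fix s :: real assume s: "0 \<le> s" "s \<le> x"
    let ?z = "a + of_real s * 1"
    have z: "?z \<in> slit lc" by (rule slit_upper) (use a \<eta> lc in auto)
    have d: "(?u has_real_derivative Im (phase' lc L ?z * 1) - arctan \<eta> * 1) (at s)"
      by (intro DERIV_diff DERIV_cmult DERIV_ident has_real_derivative_Im_ray
          phase_has_field_derivative z lc)
    have "Im (Ln (1 - ?z)) \<le> - arctan \<eta>" by (rule Im_Ln_one_minus_le) (use a \<eta> s in auto)
    moreover have "0 \<le> Im (Ln (1 + of_real lc * ?z))"
    proof -
      have "0 \<le> Im (1 + of_real lc * ?z)" using a \<eta> lc by auto
      moreover have "1 + of_real lc * ?z \<noteq> 0" using z by (auto simp: slit_def)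
      ultimately show ?thesis using Im_Ln_pos_le by blast
    qed
    ultimately have "0 \<le> Im (phase' lc L ?z * 1) - arctan \<eta> * 1" by (simp add: phase'_def)
    with d show "\<exists>y. (?u has_real_derivative y) (at s) \<and> 0 \<le> y" by blast
  qed
  then show ?thesis by simp
qed

text \<open>Factoring \<open>z\<close> out of both logarithms leaves terms that converge as
  \<open>z\<close> tends to infinity; the sign in \<open>1 - z = - z * (1 - 1 / z)\<close> accounts
  for \<open>\<i> * pi\<close>. The exponentials of both sides agree, and locating the four
  arguments in their quadrants or half-planes excludes a discrepancy of
  \<open>2 * pi\<close>.\<close>

lemma Ln_diff_inverse:
  assumes lc: "0 < lc" and z: "0 < Re z" "0 < Im z"
  shows "Ln (1 + of_real lc * z) - Ln (1 - z) = Ln (of_real lc + 1 / z) - Ln (1 - 1 / z) + \<i> * of_real pi"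
proof (rule exp_complex_eqI)
  have z0: "z \<noteq> 0" "z \<noteq> 1" using z by auto
  have r: "Re (1 / z) > 0" "Im (1 / z) < 0"
    using z by (auto simp: Re_divide Im_divide field_simps add_pos_pos)
  have n: "1 + of_real lc * z \<noteq> 0" "1 - z \<noteq> 0" "of_real lc + 1 / z \<noteq> 0" "1 - 1 / z \<noteq> 0"
  proof -
    show "1 + of_real lc * z \<noteq> 0" using lc z by (auto simp: complex_eq_iff)
    show "1 - z \<noteq> 0" using z0 by auto
    have "Re (of_real lc + 1 / z) > 0" using r lc by (simp del: Re_divide)
    then show "of_real lc + 1 / z \<noteq> 0" by force
    show "1 - 1 / z \<noteq> 0" using z0 by auto
  qed
  have a: "0 < Im (Ln (1 + of_real lc * z))" "Im (Ln (1 + of_real lc * z)) < pi / 2"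
    using Im_Ln_pos_lt[OF n(1)] Re_Ln_pos_lt[OF n(1)] lc z by (auto simp: add_pos_pos)
  have b: "Im (Ln (1 - z)) < 0" "- pi < Im (Ln (1 - z))"
    using Im_Ln_neg[of "1 - z"] mpi_less_Im_Ln[OF n(2)] z by auto
  have c: "Im (Ln (of_real lc + 1 / z)) < 0" "- pi / 2 < Im (Ln (of_real lc + 1 / z))"
    using Im_Ln_neg[of "of_real lc + 1 / z"] Re_Ln_pos_lt[OF n(3)] lc r by (auto simp: add_pos_pos)
  have d: "0 < Im (Ln (1 - 1 / z))" "Im (Ln (1 - 1 / z)) < pi"
    using Im_Ln_pos_lt[OF n(4)] r by (auto simp del: Im_divide)
  show "\<bar>Im (Ln (1 + of_real lc * z) - Ln (1 - z)) -
      Im (Ln (of_real lc + 1 / z) - Ln (1 - 1 / z) + \<i> * of_real pi)\<bar> < 2 * pi"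
    using a b c d by simp
  have "exp (Ln (of_real lc + 1 / z) - Ln (1 - 1 / z) + \<i> * of_real pi) = - ((of_real lc + 1 / z) / (1 - 1 / z))"
    using n by (simp add: exp_add exp_diff)
  also have "\<dots> = (1 + of_real lc * z) / (1 - z)" using z0 n by (simp add: field_simps)
  also have "\<dots> = exp (Ln (1 + of_real lc * z) - Ln (1 - z))" using n by (simp add: exp_diff)
  finally show "exp (Ln (1 + of_real lc * z) - Ln (1 - z)) =
    exp (Ln (of_real lc + 1 / z) - Ln (1 - 1 / z) + \<i> * of_real pi)" by simp
qed

section \<open>Growth of the phase along rays\<close>

lemma ray_in_slit:
  assumes "0 < lc" "0 < \<phi>" "\<phi> < pi / 2" "0 \<le> r"
  shows "of_real r * cis \<phi> \<in> slit lc"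
proof (cases "r = 0")
  case False
  then have "0 < Im (of_real r * cis \<phi>)" using assms by (auto simp: sin_gt_zero)
  then show ?thesis using slit_upper assms by blast
qed (simp add: zero_in_slit)

text \<open>The quantity assumed positive is the limit at infinity of the derivative of
  \<open>Im (phase lc L z)\<close> along the ray. On the initial stretch, where the derivative has
  no known sign, compactness gives a bound. The constants depend on all parameters and are used only
  for convergence, never in an error estimate.\<close>

lemma phase_ray_growth:
  assumes lc: "0 < lc" and \<phi>: "0 < \<phi>" "\<phi> < pi / 2"
    and adm: "0 < sin \<phi> * (L + ln lc) + pi * cos \<phi>"
  obtains c C where "0 < c" "\<And>r. 0 \<le> r \<Longrightarrow> c * r - C \<le> Im (phase lc L (of_real r * cis \<phi>))"
proof -
  have sc: "0 < sin \<phi>" "0 < cos \<phi>" using \<phi> by (auto simp: sin_gt_zero cos_gt_zero)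
  let ?u = "\<lambda>r. Im (phase lc L (0 + of_real r * cis \<phi>))"
  let ?v = "\<lambda>r. Im (phase' lc L (0 + of_real r * cis \<phi>) * cis \<phi>)"
  \<comment> \<open>Half of the limiting derivative, so that the derivative eventually exceeds
    it.\<close>
  define c where "c = (sin \<phi> * (L + ln lc) + pi * cos \<phi>) / 2"
  have c: "0 < c" using adm by (simp add: c_def)
  have d: "(?u has_real_derivative ?v r) (at r)" if "0 \<le> r" for r
    by (intro has_real_derivative_Im_ray phase_has_field_derivative lc)
      (use ray_in_slit lc \<phi> that in auto)
  have lim0: "((\<lambda>r. 1 / (of_real r * cis \<phi>)) \<longlongrightarrow> 0) at_top"
  proof (rule tendsto_norm_zero_cancel)
    have "((\<lambda>r::real. 1 / \<bar>r\<bar>) \<longlongrightarrow> 0) at_top" by real_asymp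
    then show "((\<lambda>r. norm (1 / (of_real r * cis \<phi>))) \<longlongrightarrow> 0) at_top" by (simp add: norm_divide norm_mult)
  qed
  have "((\<lambda>r. (of_real L + (Ln (of_real lc + 1 / (of_real r * cis \<phi>)) - Ln (1 - 1 / (of_real r * cis \<phi>)) + \<i> * of_real pi)) * cis \<phi>)
      \<longlongrightarrow> (of_real L + (Ln (of_real lc + 0) - Ln (1 - 0) + \<i> * of_real pi)) * cis \<phi>) at_top"
    by (intro tendsto_intros lim0) (use lc in \<open>auto simp: complex_nonpos_Reals_iff\<close>)
  from tendsto_Im[OF this]
  have "((\<lambda>r. Im ((of_real L + (Ln (of_real lc + 1 / (of_real r * cis \<phi>)) - Ln (1 - 1 / (of_real r * cis \<phi>)) + \<i> * of_real pi)) * cis \<phi>))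
      \<longlongrightarrow> Im ((of_real L + (Ln (of_real lc + 0) - Ln (1 - 0) + \<i> * of_real pi)) * cis \<phi>)) at_top" .
  moreover have "Im ((of_real L + (Ln (of_real lc + 0) - Ln (1 - 0) + \<i> * of_real pi)) * cis \<phi>) = 2 * c"
    using lc by (simp add: c_def Ln_of_real algebra_simps)
  ultimately have "((\<lambda>r. Im ((of_real L + (Ln (of_real lc + 1 / (of_real r * cis \<phi>)) - Ln (1 - 1 / (of_real r * cis \<phi>)) + \<i> * of_real pi)) * cis \<phi>))
      \<longlongrightarrow> 2 * c) at_top" by simp
  then have ev: "\<forall>\<^sub>F r in at_top. c < Im ((of_real L + (Ln (of_real lc + 1 / (of_real r * cis \<phi>)) - Ln (1 - 1 / (of_real r * cis \<phi>)) + \<i> * of_real pi)) * cis \<phi>)"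
    by (rule order_tendstoD) (use c in auto)
  have "\<forall>\<^sub>F r in at_top. c \<le> ?v r"
    using ev eventually_gt_at_top[of 0]
  proof eventually_elim
    case (elim r)
    have "phase' lc L (0 + of_real r * cis \<phi>) = of_real L + (Ln (of_real lc + 1 / (of_real r * cis \<phi>)) - Ln (1 - 1 / (of_real r * cis \<phi>)) + \<i> * of_real pi)"
      using Ln_diff_inverse[OF lc, of "of_real r * cis \<phi>"] sc elim by (simp add: phase'_def)
    then show ?case using elim by simp
  qed
  then obtain R where R: "0 \<le> R" "\<And>r. R \<le> r \<Longrightarrow> c \<le> ?v r"
    unfolding eventually_at_top_linorder by (metis linorder_le_cases order_trans)
  have "continuous_on {0..R} ?u"
    by (intro continuous_at_imp_continuous_on ballI DERIV_isCont[OF d]) auto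
  from compact_imp_bounded[OF compact_continuous_image[OF this compact_Icc]]
  obtain B where B: "\<And>r. r \<in> {0..R} \<Longrightarrow> norm (?u r) \<le> B"
    unfolding bounded_iff by blast
  show ?thesis
  proof (rule that[of c "B + c * R"])
    fix r :: real assume r: "0 \<le> r"
    show "c * r - (B + c * R) \<le> Im (phase lc L (of_real r * cis \<phi>))"
    proof (cases "r \<le> R")
      case True
      then have "c * r \<le> c * R" using c by simp
      then show ?thesis using B[of r] r True by simp
    next
      case False
      have "?u R - c * R \<le> ?u r - c * r"
      proof (rule DERIV_nonneg_imp_nondecreasing[of R r "\<lambda>r. ?u r - c * r"])
        fix s assume s: "R \<le> s" "s \<le> r"
        have "((\<lambda>r. ?u r - c * r) has_real_derivative ?v s - c * 1) (at s)"
          by (rule DERIV_diff[OF d DERIV_cmult[OF DERIV_ident]]) (use s R in auto)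
        then show "\<exists>y. ((\<lambda>r. ?u r - c * r) has_real_derivative y) (at s) \<and> 0 \<le> y"
          using R(2)[OF s(1)] by (intro exI[of _ "?v s - c * 1"]) auto
      qed (use False in auto)
      then show ?thesis using B[of R] R by simp
    qed
  qed (rule c)
qed

section \<open>Deformation of the contour\<close>

text \<open>The height \<open>\<eta>\<close> keeps \<open>z\<close> away from the singularity of
  \<open>(1 - z) powr (-1/2)\<close> at 1. The other factor has exponent below 1 and base of modulus
  at least 1, so it grows at most linearly.\<close>

lemma norm_gfun_le:
  assumes \<sigma>: "1/2 \<le> \<sigma>" "\<sigma> < 1" and lc: "0 < lc" "lc \<le> 1"
    and z: "0 \<le> Re z" "\<eta> \<le> Im z" and \<eta>: "0 < \<eta>"
  shows "norm (gfun \<sigma> lc z) \<le> \<eta> powr (-1/2) * (1 + norm z)"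
proof -
  have "\<eta> \<le> norm (1 - z)" using abs_Im_le_cmod[of "1 - z"] z by simp
  then have 1: "norm (1 - z) powr (-1/2) \<le> \<eta> powr (-1/2)" using \<eta> by (intro powr_mono2') auto
  have n1: "1 \<le> norm (1 + of_real lc * z)"
    using complex_Re_le_cmod[of "1 + of_real lc * z"] z lc by (simp add: order_trans[rotated])
  then have "norm (1 + of_real lc * z) powr (\<sigma> - 1/2) \<le> norm (1 + of_real lc * z) powr 1"
    using \<sigma> by (intro powr_mono) auto
  also have "\<dots> \<le> 1 + norm z"
  proof -
    have "norm (1 + of_real lc * z) \<le> 1 + lc * norm z"
      using norm_triangle_ineq[of 1 "of_real lc * z"] lc by (simp add: norm_mult)
    also have "lc * norm z \<le> 1 * norm z" using lc by (intro mult_right_mono) auto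
    finally show ?thesis using n1 by simp
  qed
  finally have 2: "norm (1 + of_real lc * z) powr (\<sigma> - 1/2) \<le> 1 + norm z" .
  have "norm (gfun \<sigma> lc z) = norm (1 - z) powr (-1/2) * norm (1 + of_real lc * z) powr (\<sigma> - 1/2)"
    unfolding gfun_def norm_mult by (simp add: norm_powr_real_powr')
  also have "\<dots> \<le> \<eta> powr (-1/2) * (1 + norm z)" by (intro mult_mono 1 2) auto
  finally show ?thesis .
qed

lemma norm_integrand:
  "norm (integrand \<sigma> lc L N z) = norm (gfun \<sigma> lc z) * exp (- (N * Im (phase lc L z)))"
  by (simp add: integrand_def norm_mult)

lemma mult_exp_le:
  assumes "0 < k" shows "x * exp (- (k * x)) \<le> (1 / k :: real)"
proof -
  have "k * x \<le> exp (k * x)" using exp_ge_add_one_self[of "k * x"] by linarith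
  then show ?thesis using assms by (simp add: exp_minus field_simps)
qed

text \<open>Any such point is reached by following the ray up to the height of \<open>z\<close> and
  then moving right by \<open>x\<close>. Growth along the ray and growth along the horizontal line
  add up.\<close>

lemma phase_sector_growth:
  assumes lc: "0 < lc" and \<phi>: "0 < \<phi>" "\<phi> < pi / 2" and \<eta>: "0 < \<eta>"
    and adm: "0 < sin \<phi> * (L + ln lc) + pi * cos \<phi>"
  obtains m C where "0 < m"
    "\<And>z. \<eta> \<le> Im z \<Longrightarrow> Im z * cos \<phi> \<le> Re z * sin \<phi> \<Longrightarrow> m * Re z - C \<le> Im (phase lc L z)"
proof -
  have sc: "0 < sin \<phi>" "0 < cos \<phi>" using \<phi> by (auto simp: sin_gt_zero cos_gt_zero)
  obtain c C where c: "0 < c" "\<And>r. 0 \<le> r \<Longrightarrow> c * r - C \<le> Im (phase lc L (of_real r * cis \<phi>))"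
    using phase_ray_growth[OF lc \<phi> adm] by blast
  define m where "m = min c (arctan \<eta>)"
  have m: "0 < m" "m \<le> c" "m \<le> arctan \<eta>" using c \<eta> by (auto simp: m_def)
  show ?thesis
  proof (rule that[OF m(1)])
    fix z :: complex assume z: "\<eta> \<le> Im z" "Im z * cos \<phi> \<le> Re z * sin \<phi>"
    define r where "r = Im z / sin \<phi>"
    define x where "x = Re z - r * cos \<phi>"
    have r: "0 \<le> r" using z \<eta> sc by (simp add: r_def)
    have x: "0 \<le> x" using z sc by (simp add: r_def x_def field_simps)
    have ez: "z = of_real r * cis \<phi> + of_real x"
      using sc by (simp add: complex_eq_iff r_def x_def)
    have "Im (phase lc L (of_real r * cis \<phi>)) + arctan \<eta> * x \<le> Im (phase lc L z)"
    proof -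
      have "0 \<le> r * cos \<phi>" using r sc by simp
      moreover have "\<eta> \<le> r * sin \<phi>" using sc z by (simp add: r_def)
      ultimately show ?thesis
        unfolding ez using phase_horizontal[OF lc _ _ \<eta> x] by auto
    qed
    moreover have "c * r - C \<le> Im (phase lc L (of_real r * cis \<phi>))" using c r by blast
    moreover have "m * x \<le> arctan \<eta> * x" using m x by (simp add: mult_right_mono)
    moreover have "m * (r * cos \<phi>) \<le> c * r"
    proof -
      have "m * (r * cos \<phi>) \<le> c * (r * 1)"
        using m c r sc by (intro mult_mono) auto
      then show ?thesis by simp
    qed
    moreover have "m * Re z = m * (r * cos \<phi>) + m * x" by (simp add: x_def algebra_simps)
    ultimately show "m * Re z - C \<le> Im (phase lc L z)" by linarith
  qed
qed

lemma integrand_sector_decay: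
  assumes \<sigma>: "1/2 \<le> \<sigma>" "\<sigma> < 1" and lc: "0 < lc" "lc \<le> 1" and N: "0 < N"
    and \<phi>: "0 < \<phi>" "\<phi> < pi / 2" and \<eta>: "0 < \<eta>"
    and adm: "0 < sin \<phi> * (L + ln lc) + pi * cos \<phi>"
  obtains k C where "0 < k"
    "\<And>z. \<eta> \<le> Im z \<Longrightarrow> Im z * cos \<phi> \<le> Re z * sin \<phi> \<Longrightarrow>
       norm (integrand \<sigma> lc L N z) \<le> C * exp (- (k * Re z))"
proof -
  have sc: "0 < sin \<phi>" "0 < cos \<phi>" using \<phi> by (auto simp: sin_gt_zero cos_gt_zero)
  obtain m C where m: "0 < m"
    "\<And>z. \<eta> \<le> Im z \<Longrightarrow> Im z * cos \<phi> \<le> Re z * sin \<phi> \<Longrightarrow> m * Re z - C \<le> Im (phase lc L z)"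
    using phase_sector_growth[OF lc(1) \<phi> \<eta> adm] by blast
  \<comment> \<open>Only half of the decay rate is kept; the other half absorbs the linear growth of
    \<open>gfun\<close>.\<close>
  define k where "k = N * m / 2"
  have k: "0 < k" using m N by (simp add: k_def)
  let ?D = "\<eta> powr (-1/2) * (1 + (1 + tan \<phi>) / k) * exp (N * C)"
  show ?thesis
  proof (rule that[OF k])
    fix z assume z: "\<eta> \<le> Im z" "Im z * cos \<phi> \<le> Re z * sin \<phi>"
    have "0 \<le> Im z * cos \<phi>" using z \<eta> sc by simp
    then have "0 \<le> Re z * sin \<phi>" using z by linarith
    then have re: "0 \<le> Re z" using sc by (simp add: zero_le_mult_iff)
    have "Im z \<le> Re z * tan \<phi>" using z sc by (simp add: tan_def field_simps)
    then have nz: "norm z \<le> Re z * (1 + tan \<phi>)"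
      using cmod_le[of z] re z \<eta> by (simp add: distrib_left)
    have T: "0 < tan \<phi>" using sc by (simp add: tan_def)
    have "N * (m * Re z - C) \<le> N * Im (phase lc L z)" using m(2)[OF z] N by simp
    then have e: "exp (- (N * Im (phase lc L z))) \<le> exp (N * C) * (exp (- (k * Re z)) * exp (- (k * Re z)))"
      by (simp add: k_def algebra_simps flip: exp_add)
    have x: "(1 + norm z) * exp (- (k * Re z)) \<le> 1 + (1 + tan \<phi>) / k"
    proof -
      have "(1 + norm z) * exp (- (k * Re z)) \<le> (1 + Re z * (1 + tan \<phi>)) * exp (- (k * Re z))"
        using nz by (intro mult_right_mono) auto
      also have "\<dots> = exp (- (k * Re z)) + (1 + tan \<phi>) * (Re z * exp (- (k * Re z)))"
        by (simp add: algebra_simps)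
      also have "\<dots> \<le> 1 + (1 + tan \<phi>) * (1 / k)"
        using T k re by (intro add_mono mult_left_mono mult_exp_le) auto
      finally show ?thesis by simp
    qed
    have "norm (integrand \<sigma> lc L N z) \<le> (\<eta> powr (-1/2) * (1 + norm z)) * (exp (N * C) * (exp (- (k * Re z)) * exp (- (k * Re z))))"
      unfolding norm_integrand by (intro mult_mono norm_gfun_le \<sigma> lc re z \<eta> e) auto
    also have "\<dots> = (\<eta> powr (-1/2) * exp (N * C) * exp (- (k * Re z))) * ((1 + norm z) * exp (- (k * Re z)))"
      by (simp add: mult_ac)
    also have "\<dots> \<le> (\<eta> powr (-1/2) * exp (N * C) * exp (- (k * Re z))) * (1 + (1 + tan \<phi>) / k)"
      by (intro mult_left_mono x) auto
    also have "\<dots> = ?D * exp (- (k * Re z))" by (simp add: mult_ac)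
    finally show "norm (integrand \<sigma> lc L N z) \<le> ?D * exp (- (k * Re z))" .
  qed
qed

lemma exp_bound_extend:
  fixes f :: "real \<Rightarrow> complex"
  assumes cont: "continuous_on {c..} f" and k: "0 < k"
    and bound: "\<And>r. R \<le> r \<Longrightarrow> c \<le> r \<Longrightarrow> norm (f r) \<le> C * exp (- (k * r))"
  obtains D where "\<And>r. c \<le> r \<Longrightarrow> norm (f r) \<le> D * exp (- (k * r))"
proof -
  have "continuous_on {c..R} f" by (rule continuous_on_subset[OF cont]) auto
  from compact_imp_bounded[OF compact_continuous_image[OF this compact_Icc]]
  obtain B where B: "\<And>r. r \<in> {c..R} \<Longrightarrow> norm (f r) \<le> B" unfolding bounded_iff by blast
  show ?thesis
  proof (rule that[of "max C (max B 0 * exp (k * R))"])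
    fix r assume r: "c \<le> r"
    show "norm (f r) \<le> max C (max B 0 * exp (k * R)) * exp (- (k * r))"
    proof (cases "R \<le> r")
      case True
      have "C * exp (- (k * r)) \<le> max C (max B 0 * exp (k * R)) * exp (- (k * r))"
        by (intro mult_right_mono) auto
      then show ?thesis using bound[OF True r] by linarith
    next
      case False
      then have "norm (f r) \<le> max B 0 * 1" using B[of r] r by auto
      also have "\<dots> \<le> max B 0 * (exp (k * R) * exp (- (k * r)))"
        using False k by (intro mult_left_mono) (auto simp flip: exp_add)
      also have "\<dots> \<le> max C (max B 0 * exp (k * R)) * exp (- (k * r))"
        by (simp only: mult.assoc[symmetric]) (intro mult_right_mono, auto)
      finally show ?thesis .
    qed
  qed
qed

lemma ray_integral_limit:
  fixes f P :: "complex \<Rightarrow> complex"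
  assumes P: "\<And>r. 0 \<le> r \<Longrightarrow> (P has_field_derivative f (c + of_real r * cis \<theta>)) (at (c + of_real r * cis \<theta>))"
    and f: "\<And>r. 0 \<le> r \<Longrightarrow> isCont f (c + of_real r * cis \<theta>)"
    and k: "0 < k"
    and bound: "\<And>r. R \<le> r \<Longrightarrow> 0 \<le> r \<Longrightarrow> norm (f (c + of_real r * cis \<theta>)) \<le> C * exp (- (k * r))"
  shows "((\<lambda>r. P (c + of_real r * cis \<theta>)) \<longlongrightarrow> P c + ray_integral f c \<theta>) at_top"
proof -
  let ?f = "\<lambda>r. f (c + of_real r * cis \<theta>) * cis \<theta>"
  have cont: "continuous_on {0..} ?f"
  proof (rule continuous_at_imp_continuous_on, rule ballI)
    fix r :: real assume "r \<in> {0..}"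
    then have "isCont f (c + of_real r * cis \<theta>)" using f by simp
    then show "isCont ?f r"
      by (intro continuous_intros isCont_o2[where f="\<lambda>r. c + of_real r * cis \<theta>"])
  qed
  obtain D where D: "\<And>r. 0 \<le> r \<Longrightarrow> norm (?f r) \<le> D * exp (- (k * r))"
    by (rule exp_bound_extend[OF cont k, of R C]) (use bound in \<open>auto simp: norm_mult\<close>)
  have "((\<lambda>r. P (c + of_real r * cis \<theta>)) \<longlongrightarrow> P (c + of_real 0 * cis \<theta>) + integral {0..} ?f) at_top"
    by (rule integral_half_line_limit[OF cont D k]) (auto intro: has_vector_derivative_ray P)
  then show ?thesis by (simp add: ray_integral_def)
qed

text \<open>The ray of direction \<open>\<phi>\<close> may be replaced by a segment of direction \<open>\<pi>/4\<close> followed by a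
  horizontal half-line: both ends at infinity are joined by vertical segments inside the sector
  of exponential decay.\<close>

lemma ray_integral_deform:
  assumes \<sigma>: "1/2 \<le> \<sigma>" "\<sigma> < 1" and lc: "0 < lc" "lc \<le> 1" and N: "0 < N"
    and \<phi>: "0 < \<phi>" "\<phi> < pi / 2" and \<rho>: "0 < \<rho>"
    and adm: "0 < sin \<phi> * (L + ln lc) + pi * cos \<phi>"
  shows "ray_integral (integrand \<sigma> lc L N) 0 \<phi> =
    integral {0..\<rho>} (\<lambda>r. integrand \<sigma> lc L N (of_real r * cis (pi/4)) * cis (pi/4)) +
    ray_integral (integrand \<sigma> lc L N) (of_real \<rho> * cis (pi/4)) 0"
proof -
  let ?f = "integrand \<sigma> lc L N"
  define a where "a = of_real \<rho> * cis (pi/4)"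
  define \<eta> where "\<eta> = \<rho> * (sqrt 2 / 2)"
  have \<eta>: "0 < \<eta>" using \<rho> by (simp add: \<eta>_def)
  have a: "Re a = \<eta>" "Im a = \<eta>" by (auto simp: a_def \<eta>_def cos_45 sin_45)
  have sc: "0 < sin \<phi>" "0 < cos \<phi>" using \<phi> by (auto simp: sin_gt_zero cos_gt_zero)
  obtain P where P: "\<And>z. z \<in> slit lc \<Longrightarrow> (P has_field_derivative ?f z) (at z)"
    using integrand_primitive[OF lc(1)] by blast
  have cf: "isCont ?f z" if "z \<in> slit lc" for z
    using integrand_differentiable[OF that lc(1)] by (rule field_differentiable_imp_continuous_at)
  obtain k C where k: "0 < k" and dec:
    "\<And>z. \<eta> \<le> Im z \<Longrightarrow> Im z * cos \<phi> \<le> Re z * sin \<phi> \<Longrightarrow> norm (?f z) \<le> C * exp (- (k * Re z))"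
    using integrand_sector_decay[OF \<sigma> lc N \<phi> \<eta> adm] by blast
  have l1: "((\<lambda>r. P (0 + of_real r * cis \<phi>)) \<longlongrightarrow> P 0 + ray_integral ?f 0 \<phi>) at_top"
  proof (rule ray_integral_limit[where k="k * cos \<phi>" and R="\<eta> / sin \<phi>" and C=C])
    show "norm (?f (0 + of_real r * cis \<phi>)) \<le> C * exp (- (k * cos \<phi> * r))" if "\<eta> / sin \<phi> \<le> r" for r
      using dec[of "of_real r * cis \<phi>"] that sc by (simp add: field_simps)
  qed (use ray_in_slit[OF lc(1) \<phi>] P cf k sc in auto)
  have l2: "((\<lambda>r. P (a + of_real r * cis 0)) \<longlongrightarrow> P a + ray_integral ?f a 0) at_top"
  proof (rule ray_integral_limit[where k=k and R="\<eta> * (cos \<phi> / sin \<phi>)" and C="max C 0"])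
    show "norm (?f (a + of_real r * cis 0)) \<le> max C 0 * exp (- (k * r))"
      if r: "\<eta> * (cos \<phi> / sin \<phi>) \<le> r" "0 \<le> r" for r
    proof -
      have "\<eta> * cos \<phi> \<le> r * sin \<phi>" using r sc by (simp add: field_simps)
      also have "\<dots> \<le> (\<eta> + r) * sin \<phi>" using \<eta> sc by (intro mult_right_mono) auto
      finally have "norm (?f (a + of_real r * cis 0)) \<le> C * exp (- (k * (\<eta> + r)))"
        using dec[of "a + of_real r * cis 0"] a by simp
      \<comment> \<open>The sign of \<open>C\<close> is not known, so it is replaced by
        \<open>max C 0\<close> before the factor \<open>exp (- (k * \<eta>))\<close> is
        dropped.\<close>
      also have "\<dots> \<le> max C 0 * exp (- (k * r))" using k \<eta> by (intro mult_mono) auto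
      finally show ?thesis .
    qed
  qed (use slit_upper[OF _ lc(1)] P cf k a \<eta> in auto)
  let ?p = "\<lambda>r. of_real r * cis \<phi>"
  \<comment> \<open>Shifted so that \<open>?p r\<close> and \<open>?q r\<close> have the same real
    part \<open>r * cos \<phi>\<close>. The vertical segment between them has length at most
    \<open>r\<close>, while the integrand on it is exponentially small in \<open>r\<close>.\<close>
  let ?q = "\<lambda>r. a + of_real (r * cos \<phi> - \<eta>)"
  have diff: "((\<lambda>r. P (?p r) - P (?q r)) \<longlongrightarrow> 0) at_top"
  proof (rule Lim_null_comparison)
    show "\<forall>\<^sub>F r in at_top. norm (P (?p r) - P (?q r)) \<le> max C 0 * exp (- (k * (r * cos \<phi>))) * r"
      using eventually_ge_at_top[of "\<eta> / sin \<phi>"]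
    proof eventually_elim
      case (elim r)
      have "0 \<le> \<eta> / sin \<phi>" using sc \<eta> by simp
      with elim have "0 \<le> r" by linarith
      with elim have r: "\<eta> \<le> r * sin \<phi>" "0 \<le> r" using sc by (simp_all add: field_simps)
      let ?S = "{z. Re z = r * cos \<phi> \<and> \<eta> \<le> Im z \<and> Im z \<le> r * sin \<phi>}"
      have S: "convex ?S"
      proof -
        have "?S = {z. Re z \<le> r * cos \<phi>} \<inter> {z. r * cos \<phi> \<le> Re z} \<inter> {z. \<eta> \<le> Im z} \<inter> {z. Im z \<le> r * sin \<phi>}" by auto
        then show ?thesis
          by (simp only:) (intro convex_Int convex_halfspace_Im_ge convex_halfspace_Im_le
                convex_halfspace_Re_ge convex_halfspace_Re_le)
      qed
      have "norm (P (?p r) - P (?q r)) \<le> max C 0 * exp (- (k * (r * cos \<phi>))) * norm (?p r - ?q r)"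
      proof (rule field_differentiable_bound[OF S, where f'="?f"])
        fix z assume z: "z \<in> ?S"
        then have "z \<in> slit lc" using slit_upper[OF _ lc(1)] \<eta> by auto
        then show "(P has_field_derivative ?f z) (at z within ?S)"
          by (rule has_field_derivative_at_within[OF P])
        have "Im z * cos \<phi> \<le> r * sin \<phi> * cos \<phi>" using z sc by (intro mult_right_mono) auto
        then have "norm (?f z) \<le> C * exp (- (k * (r * cos \<phi>)))"
          using dec[of z] z by (simp add: mult_ac)
        also have "\<dots> \<le> max C 0 * exp (- (k * (r * cos \<phi>)))" by (intro mult_right_mono) auto
        finally show "norm (?f z) \<le> max C 0 * exp (- (k * (r * cos \<phi>)))" .
      qed (use a r in auto)
      also have "norm (?p r - ?q r) \<le> r"
      proof -
        have "?p r - ?q r = \<i> * of_real (r * sin \<phi> - \<eta>)" by (simp add: complex_eq_iff a)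
        then have "norm (?p r - ?q r) = \<bar>r * sin \<phi> - \<eta>\<bar>" by (simp only: norm_mult norm_of_real norm_ii mult_1)
        also have "\<dots> \<le> r * 1" using r \<eta> mult_left_mono[OF sin_le_one r(2), of \<phi>] by simp
        finally show ?thesis by simp
      qed
      finally show ?case by (simp add: mult_left_mono)
    qed
    have *: "((\<lambda>r. exp (- (K * r)) * r) \<longlongrightarrow> 0) at_top" if "0 < K" for K :: real
      using that by real_asymp
    have "((\<lambda>r. max C 0 * (exp (- ((k * cos \<phi>) * r)) * r)) \<longlongrightarrow> 0) at_top"
      by (rule tendsto_mult_right_zero[OF *]) (use k sc in simp)
    then show "((\<lambda>r. max C 0 * exp (- (k * (r * cos \<phi>))) * r) \<longlongrightarrow> 0) at_top" by (simp add: mult_ac)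
  qed
  have p: "((\<lambda>r. P (?p r)) \<longlongrightarrow> P 0 + ray_integral ?f 0 \<phi>) at_top" using l1 by simp
  have q: "((\<lambda>r. P (?q r)) \<longlongrightarrow> P a + ray_integral ?f a 0) at_top"
  proof -
    have "filterlim (\<lambda>r. r * cos \<phi> - \<eta>) at_top at_top" using sc by real_asymp
    from filterlim_compose[OF l2 this] show ?thesis by simp
  qed
  have "P 0 + ray_integral ?f 0 \<phi> - (P a + ray_integral ?f a 0) = 0"
    by (rule tendsto_unique[OF trivial_limit_at_top_linorder tendsto_diff[OF p q] diff])
  then have e: "ray_integral ?f 0 \<phi> = (P a - P 0) + ray_integral ?f a 0"
    by (simp add: algebra_simps)
  have "((\<lambda>r. ?f (0 + of_real r * cis (pi/4)) * cis (pi/4)) has_integral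
      P (0 + of_real \<rho> * cis (pi/4)) - P (0 + of_real 0 * cis (pi/4))) {0..\<rho>}"
  proof (rule fundamental_theorem_of_calculus)
    fix r assume "r \<in> {0..\<rho>}"
    then have "of_real r * cis (pi/4) \<in> slit lc" by (intro ray_in_slit lc) auto
    then show "((\<lambda>r. P (0 + of_real r * cis (pi/4))) has_vector_derivative
        ?f (0 + of_real r * cis (pi/4)) * cis (pi/4)) (at r within {0..\<rho>})"
      by (intro has_vector_derivative_at_within[OF has_vector_derivative_ray] P) simp
  qed (use \<rho> in simp)
  from integral_unique[OF this]
  have "integral {0..\<rho>} (\<lambda>r. ?f (of_real r * cis (pi/4)) * cis (pi/4)) = P a - P 0"
    by (simp only: a_def add_0 of_real_0 mult_zero_left)
  then show ?thesis unfolding e a_def[symmetric] by (simp only:)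
qed

section \<open>The quadratic model near the origin\<close>

lemma norm_exp_minus_one_le: "norm (exp w - 1) \<le> norm w * exp (norm w)" for w :: complex
proof -
  have "norm (exp w - exp 0) \<le> exp (norm w) * norm (w - 0)"
  proof (rule field_differentiable_bound[of "cball 0 (norm w)"])
    fix z :: complex assume "z \<in> cball 0 (norm w)"
    then have "norm z \<le> norm w" by simp
    then show "norm (exp z) \<le> exp (norm w)" using norm_exp[of z] by (meson exp_le_cancel_iff order_trans)
    show "(exp has_field_derivative exp z) (at z within cball 0 (norm w))"
      by (rule has_field_derivative_at_within[OF DERIV_exp])
  qed auto
  then show ?thesis by (simp add: mult.commute)
qed

lemma slit_near:
  assumes "norm z < 1" "0 < lc" "lc \<le> 1"
  shows "z \<in> slit lc"
proof -
  have z: "\<bar>Re z\<bar> < 1" using abs_Re_le_cmod[of z] assms by linarith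
  moreover have "lc * \<bar>Re z\<bar> \<le> 1 * \<bar>Re z\<bar>" using assms by (intro mult_right_mono) auto
  ultimately have "\<bar>lc * Re z\<bar> < 1" using assms by (simp add: abs_mult)
  then show ?thesis using z by (auto simp: slit_def complex_nonpos_Reals_iff)
qed

text \<open>The term \<open>L * z\<close> cancels, so only the two logarithms in the derivative
  contribute and the bound is independent of \<open>L\<close>. Each differs from its linear part by
  at most \<open>2 * norm z ^ 2\<close>; both functions vanish at 0, and the mean value bound adds
  the third power.\<close>

lemma phase_taylor:
  assumes lc: "0 < lc" "lc \<le> 1" and z: "norm z \<le> 1/4"
  shows "norm (phase lc L z - (of_real L * z + of_real ((1 + lc) / 2) * z\<^sup>2)) \<le> 4 * norm z ^ 3"
proof -
  let ?h = "\<lambda>z. phase lc L z - (of_real L * z + of_real ((1 + lc) / 2) * z\<^sup>2)"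
  have "norm (?h z - ?h 0) \<le> (4 * (norm z)\<^sup>2) * norm (z - 0)"
  proof (rule field_differentiable_bound[of "cball 0 (norm z)" ?h
      "\<lambda>z. phase' lc L z - (of_real L + of_real (1 + lc) * z)"])
    fix w :: complex assume "w \<in> cball 0 (norm z)"
    then have w: "norm w \<le> norm z" by simp
    have q: "((\<lambda>z. of_real L * z + of_real ((1 + lc) / 2) * z\<^sup>2) has_field_derivative
        of_real L + of_real (1 + lc) * w) (at w)"
      by (auto intro!: derivative_eq_intros)
    have "w \<in> slit lc" by (rule slit_near) (use w z lc in auto)
    from has_field_derivative_at_within[OF DERIV_diff[OF phase_has_field_derivative[OF this lc(1)] q]]
    show "(?h has_field_derivative phase' lc L w - (of_real L + of_real (1 + lc) * w)) (at w within cball 0 (norm z))" .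
    have ln: "norm (Ln (1 + v) - v) \<le> 2 * (norm z)\<^sup>2" if v: "norm v \<le> norm z" for v
    proof -
      have "norm (Ln (1 + v) - v) \<le> (norm v)\<^sup>2 / (1 - norm v)"
        by (rule Ln_approx_linear) (use v z in auto)
      also have "\<dots> \<le> (norm z)\<^sup>2 / (1 / 2)"
        by (rule frac_le) (use v z in \<open>auto intro: power_mono\<close>)
      finally show ?thesis by simp
    qed
    have "norm (of_real lc * w) \<le> norm w"
      using lc mult_right_mono[of lc 1 "norm w"] by (simp add: norm_mult)
    then have l: "norm (of_real lc * w) \<le> norm z" "norm (- w) \<le> norm z" using w by auto
    have "phase' lc L w - (of_real L + of_real (1 + lc) * w) =
       (Ln (1 + of_real lc * w) - of_real lc * w) - (Ln (1 + - w) - (- w))"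
      by (simp add: phase'_def algebra_simps)
    then show "norm (phase' lc L w - (of_real L + of_real (1 + lc) * w)) \<le> 4 * (norm z)\<^sup>2"
      using norm_triangle_ineq4[of "Ln (1 + of_real lc * w) - of_real lc * w" "Ln (1 + - w) - (- w)"]
        ln[OF l(1)] ln[OF l(2)] by simp
  qed auto
  then show ?thesis by (simp add: phase_def power2_eq_square power3_eq_cube mult_ac)
qed

lemma gfun_near:
  assumes \<sigma>: "1/2 \<le> \<sigma>" "\<sigma> < 1" and lc: "0 < lc" "lc \<le> 1" and z: "norm z \<le> 1/4"
  shows "norm (gfun \<sigma> lc z - 1) \<le> 4 * norm z"
proof -
  let ?w = "(-1/2) * Ln (1 - z) + of_real (\<sigma> - 1/2) * Ln (1 + of_real lc * z)"
  have s: "z \<in> slit lc" by (rule slit_near) (use z lc in auto)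
  then have n: "1 - z \<noteq> 0" "1 + of_real lc * z \<noteq> 0" by (auto simp: slit_def)
  have g: "gfun \<sigma> lc z = exp ?w"
    using n unfolding gfun_def powr_def by (simp flip: exp_add)
  have lz: "norm (of_real lc * z) \<le> norm z"
    using lc mult_right_mono[of lc 1 "norm z"] by (simp add: norm_mult)
  have a: "norm (Ln (1 + - z)) \<le> 2 * norm z" using norm_Ln_le[of "- z"] z by simp
  have b: "norm (Ln (1 + of_real lc * z)) \<le> 2 * norm z"
    using norm_Ln_le[of "of_real lc * z"] z lz by linarith
  have "norm ?w \<le> (1/2) * norm (Ln (1 + - z)) + \<bar>\<sigma> - 1/2\<bar> * norm (Ln (1 + of_real lc * z))"
    by (rule order_trans[OF norm_triangle_ineq]) (simp only: norm_mult norm_of_real, simp)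
  also have "\<dots> \<le> (1/2) * (2 * norm z) + (1/2) * (2 * norm z)"
    using \<sigma> by (intro add_mono mult_mono a b) auto
  finally have w: "norm ?w \<le> 2 * norm z" by simp
  have "norm (gfun \<sigma> lc z - 1) \<le> norm ?w * exp (norm ?w)"
    unfolding g by (rule norm_exp_minus_one_le)
  also have "\<dots> \<le> (2 * norm z) * 2"
  proof (rule mult_mono[OF w])
    have "exp (norm ?w) \<le> exp (1/2)" using w z by simp
    also have "\<dots> \<le> 2" using real_exp_bound_lemma[of "1/2"] by simp
    finally show "exp (norm ?w) \<le> 2" .
  qed auto
  finally show ?thesis by simp
qed

text \<open>The integrand with the phase cut to its second-order Taylor polynomial at 0 and the
  amplitude \<open>gfun\<close> replaced by its value 1 there.\<close>

definition model :: "real \<Rightarrow> real \<Rightarrow> real \<Rightarrow> complex \<Rightarrow> complex" where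
  "model lc L N z = exp (\<i> * of_real N * (of_real L * z + of_real ((1 + lc) / 2) * z\<^sup>2))"

lemma diagonal:
  "Im (of_real r * cis (pi/4)) = r * (sqrt 2 / 2)" "Re (of_real r * cis (pi/4)) = r * (sqrt 2 / 2)"
  "(of_real r * cis (pi/4))\<^sup>2 = \<i> * of_real (r\<^sup>2)"
proof -
  have "(cis (pi/4))\<^sup>2 = \<i>" unfolding power2_eq_square cis_mult by simp
  then show "(of_real r * cis (pi/4))\<^sup>2 = \<i> * of_real (r\<^sup>2)" by (simp add: power_mult_distrib)
qed (auto simp: cos_45 sin_45)

lemma norm_model_diagonal:
  "norm (model lc L N (of_real r * cis (pi/4))) = exp (- (N * (L * r * (sqrt 2 / 2) + (1 + lc) / 2 * r\<^sup>2)))"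
  unfolding model_def diagonal(3) norm_exp_eq_Re by (simp add: cos_45 sin_45 field_simps)

text \<open>For \<open>r \<le> 1/16\<close> the cubic remainder \<open>4 r\<^sup>3\<close> is at most \<open>r\<^sup>2 / 4\<close>, half of the quadratic term.\<close>

lemma Im_phase_diagonal_ge:
  assumes lc: "0 < lc" "lc \<le> 1" and r: "0 \<le> r" "r \<le> 1/16"
  shows "L * r * (sqrt 2 / 2) + r\<^sup>2 / 4 \<le> Im (phase lc L (of_real r * cis (pi/4)))"
proof -
  let ?z = "of_real r * cis (pi/4)"
  let ?q = "of_real L * ?z + of_real ((1 + lc) / 2) * ?z\<^sup>2"
  have nz: "norm ?z = r" using r by (simp add: norm_mult)
  have "norm (phase lc L ?z - ?q) \<le> 4 * r ^ 3" using phase_taylor[OF lc, of ?z L] r nz by simp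
  then have "\<bar>Im (phase lc L ?z) - Im ?q\<bar> \<le> 4 * r ^ 3"
    using abs_Im_le_cmod[of "phase lc L ?z - ?q"] by simp
  moreover have "4 * r ^ 3 \<le> r\<^sup>2 / 4"
    using mult_left_mono[OF r(2), of "r\<^sup>2"] by (simp add: power2_eq_square power3_eq_cube)
  moreover have "Im ?q = L * r * (sqrt 2 / 2) + (1 + lc) / 2 * r\<^sup>2"
    unfolding diagonal(3) by (simp add: sin_45)
  moreover have "1 / 2 * r\<^sup>2 \<le> (1 + lc) / 2 * r\<^sup>2" using lc by (intro mult_right_mono) auto
  ultimately show ?thesis by linarith
qed

text \<open>Amplitude and phase are replaced one at a time. The factor
  \<open>exp (N * norm p)\<close> from the phase error is at most
  \<open>exp (N * r\<^sup>2 / 4)\<close> and is paid for by half of the available Gaussian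
  \<open>exp (- N * r\<^sup>2 / 2)\<close>, so both errors carry the same damping.\<close>

lemma integrand_near:
  assumes \<sigma>: "1/2 \<le> \<sigma>" "\<sigma> < 1" and lc: "0 < lc" "lc \<le> 1" and N: "0 < N" and L: "0 \<le> L"
    and r: "0 \<le> r" "r \<le> 1/16"
  defines "z \<equiv> of_real r * cis (pi/4)"
  shows "norm (integrand \<sigma> lc L N z - model lc L N z) \<le>
    (4 * r + 4 * N * r ^ 3) * exp (- (N * (L * r * (sqrt 2 / 2) + r\<^sup>2 / 4)))"
proof -
  let ?q = "of_real L * z + of_real ((1 + lc) / 2) * z\<^sup>2"
  let ?E = "exp (- (N * (L * r * (sqrt 2 / 2) + r\<^sup>2 / 4)))"
  have nz: "norm z = r" using r by (simp add: norm_mult z_def)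
  define p where "p = phase lc L z - ?q"
  have p: "norm p \<le> 4 * r ^ 3" unfolding p_def using phase_taylor[OF lc, of z L] r nz by simp
  have r3: "4 * r ^ 3 \<le> r\<^sup>2 / 4"
    using mult_left_mono[OF r(2), of "r\<^sup>2"] by (simp add: power2_eq_square power3_eq_cube)
  have e1: "exp (- (N * Im (phase lc L z))) \<le> ?E"
    using Im_phase_diagonal_ge[OF lc r, of L] N unfolding z_def by simp
  have "\<i> * of_real N * phase lc L z = \<i> * of_real N * ?q + \<i> * of_real N * p"
    by (simp add: p_def algebra_simps)
  then have "exp (\<i> * of_real N * phase lc L z) = model lc L N z * exp (\<i> * of_real N * p)"
    by (simp add: model_def exp_add)
  then have "integrand \<sigma> lc L N z - model lc L N z =
     (gfun \<sigma> lc z - 1) * exp (\<i> * of_real N * phase lc L z) + model lc L N z * (exp (\<i> * of_real N * p) - 1)"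
    by (simp add: integrand_def algebra_simps)
  then have "norm (integrand \<sigma> lc L N z - model lc L N z) \<le>
      norm ((gfun \<sigma> lc z - 1) * exp (\<i> * of_real N * phase lc L z)) + norm (model lc L N z * (exp (\<i> * of_real N * p) - 1))"
    by (simp only: norm_triangle_ineq)
  also have "norm ((gfun \<sigma> lc z - 1) * exp (\<i> * of_real N * phase lc L z)) \<le> 4 * r * ?E"
  proof -
    have "norm (gfun \<sigma> lc z - 1) \<le> 4 * r" using gfun_near[OF \<sigma> lc, of z] nz r by simp
    then show ?thesis unfolding norm_mult by (intro mult_mono) (use e1 r in auto)
  qed
  also have "norm (model lc L N z * (exp (\<i> * of_real N * p) - 1)) \<le> 4 * N * r ^ 3 * ?E"
  proof -
    have Np: "norm (\<i> * of_real N * p) \<le> N * (4 * r ^ 3)" using p N by (simp add: norm_mult)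
    have "N * (4 * r ^ 3) \<le> N * (r\<^sup>2 / 4)" using r3 N by (intro mult_left_mono) auto
    then have "exp (norm (\<i> * of_real N * p)) \<le> exp (N * (r\<^sup>2 / 4))" using Np by simp
    then have "norm (exp (\<i> * of_real N * p) - 1) \<le> (N * (4 * r ^ 3)) * exp (N * (r\<^sup>2 / 4))"
      using Np N r by (intro order_trans[OF norm_exp_minus_one_le] mult_mono) auto
    moreover have "norm (model lc L N z) \<le> exp (- (N * (L * r * (sqrt 2 / 2) + r\<^sup>2 / 2)))"
    proof -
      have "1 / 2 * r\<^sup>2 \<le> (1 + lc) / 2 * r\<^sup>2" using lc by (intro mult_right_mono) auto
      then show ?thesis unfolding z_def norm_model_diagonal using N by simp
    qed
    ultimately have "norm (model lc L N z * (exp (\<i> * of_real N * p) - 1)) \<le>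
       exp (- (N * (L * r * (sqrt 2 / 2) + r\<^sup>2 / 2))) * ((N * (4 * r ^ 3)) * exp (N * (r\<^sup>2 / 4)))"
      unfolding norm_mult by (intro mult_mono) auto
    also have "\<dots> = 4 * N * r ^ 3 * (exp (- (N * (L * r * (sqrt 2 / 2) + r\<^sup>2 / 2))) * exp (N * (r\<^sup>2 / 4)))"
      by simp
    also have "\<dots> = 4 * N * r ^ 3 * ?E"
      unfolding exp_add[symmetric] by (simp add: algebra_simps)
    finally show ?thesis .
  qed
  finally show ?thesis by (simp add: algebra_simps)
qed

text \<open>The constant \<open>112 = 4 + 4 * 27\<close> comes from \<open>u \<le> exp u\<close> and
  \<open>u ^ 3 \<le> 27 * exp u\<close>; \<open>exp 4\<close> comes from completing the square in
  \<open>2 * u - u\<^sup>2 / 4 \<le> 4\<close>.\<close>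

lemma cubic_gaussian_le:
  fixes u :: real
  assumes u: "0 \<le> u"
  shows "(4 * u + 4 * u ^ 3) * exp (- (u\<^sup>2 / 4)) \<le> 112 * exp 4 * exp (- u)"
proof -
  have "u / 3 \<le> exp (u / 3)" using exp_ge_add_one_self[of "u / 3"] by linarith
  then have "(u / 3) ^ 3 \<le> exp (u / 3) ^ 3" using u by (intro power_mono) auto
  also have "\<dots> = exp u" by (simp flip: exp_of_nat_mult)
  finally have "u ^ 3 \<le> 27 * exp u" by (simp add: power_divide)
  moreover have "u \<le> exp u" using exp_ge_add_one_self[of u] by linarith
  ultimately have "(4 * u + 4 * u ^ 3) * exp (- (u\<^sup>2 / 4)) \<le> (112 * exp u) * exp (- (u\<^sup>2 / 4))"
    by (intro mult_right_mono) auto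
  also have "\<dots> = 112 * exp (u - u\<^sup>2 / 4)" by (simp flip: exp_add)
  also have "u - u\<^sup>2 / 4 \<le> 4 + - u"
    using zero_le_power2[of "u / 2 - 2"] by (simp add: power2_eq_square algebra_simps)
  then have "112 * exp (u - u\<^sup>2 / 4) \<le> 112 * exp (4 + - u)" by simp
  finally show ?thesis by (simp only: exp_add mult.assoc)
qed

text \<open>In the variable \<open>u = sqrt N * r\<close> the polynomial becomes
  \<open>(4 * u + 4 * u ^ 3) / sqrt N\<close>, the source of the gain \<open>1 / sqrt N\<close>.
  Weakening the Gaussian to \<open>exp (- u)\<close> lets it merge with the linear damping into one
  exponential, whose integral is explicit.\<close>

lemma cubic_gaussian_scaled_le:
  assumes N: "0 < N" and r: "0 \<le> r"
  shows "(4 * r + 4 * N * r ^ 3) * exp (- (N * (L * r * (sqrt 2 / 2) + r\<^sup>2 / 4))) \<le>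
    112 * exp 4 / sqrt N * exp (- ((sqrt N + N * L * (sqrt 2 / 2)) * r))"
proof -
  let ?u = "sqrt N * r"
  have s: "sqrt N > 0" "sqrt N * sqrt N = N" using N by auto
  have 1: "4 * r + 4 * N * r ^ 3 = (4 * ?u + 4 * ?u ^ 3) / sqrt N"
    using s by (simp add: field_simps power3_eq_cube)
  have 2: "N * (L * r * (sqrt 2 / 2) + r\<^sup>2 / 4) = N * L * (sqrt 2 / 2) * r + ?u\<^sup>2 / 4"
    using N by (simp add: algebra_simps)
  have "(4 * r + 4 * N * r ^ 3) * exp (- (N * (L * r * (sqrt 2 / 2) + r\<^sup>2 / 4))) =
    ((4 * ?u + 4 * ?u ^ 3) * exp (- (?u\<^sup>2 / 4))) * (exp (- (N * L * (sqrt 2 / 2) * r)) / sqrt N)"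
    unfolding 1 2 minus_add_distrib exp_add by (simp add: mult_ac)
  also have "\<dots> \<le> (112 * exp 4 * exp (- ?u)) * (exp (- (N * L * (sqrt 2 / 2) * r)) / sqrt N)"
    by (intro mult_right_mono cubic_gaussian_le) (use s r in auto)
  also have "\<dots> = 112 * exp 4 / sqrt N * (exp (- ?u) * exp (- (N * L * (sqrt 2 / 2) * r)))"
    by simp
  also have "exp (- ?u) * exp (- (N * L * (sqrt 2 / 2) * r)) = exp (- ((sqrt N + N * L * (sqrt 2 / 2)) * r))"
    unfolding exp_add[symmetric] by (simp add: algebra_simps)
  finally show ?thesis .
qed

section \<open>Error estimates\<close>

definition near_const :: real where
  "near_const = 112 * exp 4"

text \<open>In units of \<open>near_const\<close>: 1 for the difference on the segment, 4 for the
  tail of the model, and the rest for the horizontal half-line.\<close>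

definition err_const :: real where
  "err_const = near_const * (5 + 128 * (sqrt 2 / 32) powr (-1/2))"

lemma const_pos: "0 < near_const" "0 < err_const"
  unfolding err_const_def near_const_def by (auto intro!: mult_pos_pos add_pos_nonneg)

lemma model_tail:
  assumes lc: "0 < lc" and N: "0 < N" and L: "0 \<le> L"
  defines "k \<equiv> sqrt N + N * L * (sqrt 2 / 2)"
  defines "e \<equiv> \<lambda>r. model lc L N (of_real r * cis (pi/4)) * cis (pi/4)"
  shows "e integrable_on {1/16..}"
    "norm (integral {1/16..} e) \<le> 4 * near_const / (sqrt N * k)"
proof -
  have k: "0 < k" using N L by (simp add: k_def add_pos_nonneg)
  have c: "continuous_on {1/16..} e" unfolding e_def model_def by (intro continuous_intros)
  have b: "norm (e r) \<le> 4 * near_const / sqrt N * exp (- (k * r))" if r: "1/16 \<le> r" for r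
  proof -
    have "1 / 2 * r\<^sup>2 \<le> (1 + lc) / 2 * r\<^sup>2" using lc by (intro mult_right_mono) auto
    then have "L * r * (sqrt 2 / 2) + r\<^sup>2 / 4 \<le> L * r * (sqrt 2 / 2) + (1 + lc) / 2 * r\<^sup>2"
      using zero_le_power2[of r] by linarith
    then have "norm (e r) \<le> exp (- (N * (L * r * (sqrt 2 / 2) + r\<^sup>2 / 4)))"
      unfolding e_def norm_mult norm_model_diagonal norm_cis mult_1_right
      using N by (simp only: exp_le_cancel_iff neg_le_iff_le mult_le_cancel_left_pos)
    \<comment> \<open>For \<open>r \<ge> 1/16\<close> the inserted factor is at least 1. With it the
      scaled estimate applies again, so the tail is bounded in the same form as the near
      part.\<close>
    also have "\<dots> \<le> (4 * (4 * r + 4 * N * r ^ 3)) * exp (- (N * (L * r * (sqrt 2 / 2) + r\<^sup>2 / 4)))"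
    proof -
      have *: "1 \<le> 4 * (4 * r + p)" if "0 \<le> p" for p using r that by simp
      have "1 \<le> 4 * (4 * r + 4 * N * r ^ 3)" by (rule *) (use N r in simp)
      then have "1 * exp (- (N * (L * r * (sqrt 2 / 2) + r\<^sup>2 / 4))) \<le>
         (4 * (4 * r + 4 * N * r ^ 3)) * exp (- (N * (L * r * (sqrt 2 / 2) + r\<^sup>2 / 4)))"
        by (intro mult_right_mono) auto
      then show ?thesis by simp
    qed
    also have "\<dots> \<le> 4 * (112 * exp 4 / sqrt N * exp (- (k * r)))"
      using mult_left_mono[OF cubic_gaussian_scaled_le[OF N, of r L], of 4] r
      unfolding k_def by (simp only: mult.assoc; simp?)
    finally show ?thesis by (simp add: near_const_def)
  qed
  show "e integrable_on {1/16..}" by (rule exp_dominated_integral[OF c b k])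
  have "norm (integral {1/16..} e) \<le> 4 * near_const / sqrt N * exp (- (k * (1/16))) / k"
    by (rule exp_dominated_integral[OF c b k])
  also have "\<dots> \<le> 4 * near_const / sqrt N * 1 / k"
    using const_pos N k by (intro divide_right_mono mult_left_mono) auto
  finally show "norm (integral {1/16..} e) \<le> 4 * near_const / (sqrt N * k)" by simp
qed

lemma near_difference:
  assumes \<sigma>: "1/2 \<le> \<sigma>" "\<sigma> < 1" and lc: "0 < lc" "lc \<le> 1" and N: "0 < N" and L: "0 \<le> L"
  defines "k \<equiv> sqrt N + N * L * (sqrt 2 / 2)"
  defines "e \<equiv> \<lambda>r. model lc L N (of_real r * cis (pi/4)) * cis (pi/4)"
  defines "f \<equiv> \<lambda>r. integrand \<sigma> lc L N (of_real r * cis (pi/4)) * cis (pi/4)"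
  shows "e integrable_on {0..1/16}"
    "norm (integral {0..1/16} f - integral {0..1/16} e) \<le> near_const / (sqrt N * k)"
proof -
  have k: "0 < k" using N L by (simp add: k_def add_pos_nonneg)
  have ce: "continuous_on {0..1/16} e" unfolding e_def model_def by (intro continuous_intros)
  have cf: "continuous_on {0..1/16} f"
  proof (rule continuous_at_imp_continuous_on, rule ballI)
    fix r :: real assume "r \<in> {0..1/16}"
    then have "of_real r * cis (pi/4) \<in> slit lc" by (intro ray_in_slit lc) auto
    then have "isCont (integrand \<sigma> lc L N) (of_real r * cis (pi/4))"
      using integrand_differentiable lc field_differentiable_imp_continuous_at by blast
    then show "isCont f r" unfolding f_def
      by (intro continuous_intros isCont_o2[where f="\<lambda>r. of_real r * cis (pi/4)"])
  qed
  show ie: "e integrable_on {0..1/16}" by (rule integrable_continuous_interval[OF ce])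
  have fi: "f integrable_on {0..1/16}" by (rule integrable_continuous_interval[OF cf])
  let ?D = "\<lambda>r. near_const / sqrt N * exp (- k * r)"
  have D: "(?D has_integral near_const / sqrt N * (exp (- k * 0) / k)) {0..}"
    by (intro has_integral_mult_right has_integral_exp_minus_to_infinity k)
  have Di: "?D integrable_on {0..1/16}"
    by (intro integrable_continuous_interval continuous_intros)
  have "norm (integral {0..1/16} (\<lambda>r. f r - e r)) \<le> integral {0..1/16} ?D"
  proof (rule integral_norm_bound_integral[OF integrable_diff[OF fi ie] Di])
    fix r :: real assume r: "r \<in> {0..1/16}"
    have "norm (f r - e r) = norm (integrand \<sigma> lc L N (of_real r * cis (pi/4)) - model lc L N (of_real r * cis (pi/4)))"
      unfolding f_def e_def left_diff_distrib[symmetric] norm_mult by simp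
    also have "\<dots> \<le> (4 * r + 4 * N * r ^ 3) * exp (- (N * (L * r * (sqrt 2 / 2) + r\<^sup>2 / 4)))"
      using integrand_near[OF \<sigma> lc N L] r by simp
    also have "\<dots> \<le> ?D r"
      unfolding near_const_def k_def mult_minus_left
      by (rule cubic_gaussian_scaled_le[OF N]) (use r in simp)
    finally show "norm (f r - e r) \<le> ?D r" .
  qed
  also have "\<dots> \<le> integral {0..} ?D"
    by (rule integral_subset_le[OF _ Di has_integral_integrable[OF D]])
      (use const_pos N in \<open>auto intro!: divide_nonneg_nonneg mult_nonneg_nonneg\<close>)
  also have "\<dots> = near_const / (sqrt N * k)" using integral_unique[OF D] by simp
  finally show "norm (integral {0..1/16} f - integral {0..1/16} e) \<le> near_const / (sqrt N * k)"
    using integral_diff[OF fi ie] by simp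
qed

text \<open>The corner \<open>(1/16) * cis (pi/4)\<close> has height \<open>sqrt 2 / 32\<close>. The
  condition on \<open>N\<close> makes the decay rate along the half-line at least 2: one unit
  absorbs the amplitude through \<open>1 + norm z \<le> 2 * exp r\<close>, the other gives
  convergence. Smallness, including the damping from \<open>L\<close>, comes from the phase at the
  corner.\<close>

lemma far_integral:
  assumes \<sigma>: "1/2 \<le> \<sigma>" "\<sigma> < 1" and lc: "0 < lc" "lc \<le> 1" and L: "0 \<le> L"
    and N: "2 \<le> N * arctan (sqrt 2 / 32)"
  defines "k \<equiv> sqrt N + N * L * (sqrt 2 / 2)"
  shows "norm (ray_integral (integrand \<sigma> lc L N) (of_real (1/16) * cis (pi/4)) 0) \<le>
    128 * (sqrt 2 / 32) powr (-1/2) * near_const / (sqrt N * k)"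
proof -
  define a :: complex where "a = of_real (1/16) * cis (pi/4)"
  let ?\<eta> = "sqrt 2 / 32 :: real"
  let ?I = "Im (phase lc L a)"
  have \<kappa>: "0 < arctan ?\<eta>" by simp
  have N0: "0 < N" using N \<kappa> by (smt (verit) mult_nonpos_nonneg)
  have k: "0 < k" using N0 L by (simp add: k_def add_pos_nonneg)
  have a: "Re a = ?\<eta>" "Im a = ?\<eta>" unfolding a_def diagonal by simp_all
  have a0: "0 < Re a" unfolding a by simp
  have na: "norm a = 1/16" by (simp add: norm_mult a_def)
  have c: "continuous_on {0..} (\<lambda>r. integrand \<sigma> lc L N (a + of_real r * cis 0) * cis 0)"
  proof (rule continuous_at_imp_continuous_on, rule ballI)
    fix r :: real assume "r \<in> {0..}"
    have "Im (a + of_real r * cis 0) = ?\<eta>" using a(2) by simp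
    then have "0 < Im (a + of_real r * cis 0)" by (simp only:) simp
    then have "a + of_real r * cis 0 \<in> slit lc" by (rule slit_upper[OF _ lc(1)])
    then have "isCont (integrand \<sigma> lc L N) (a + of_real r * cis 0)"
      using integrand_differentiable lc field_differentiable_imp_continuous_at by blast
    then show "isCont (\<lambda>r. integrand \<sigma> lc L N (a + of_real r * cis 0) * cis 0) r"
      by (intro continuous_intros isCont_o2[where f="\<lambda>r. a + of_real r * cis 0"])
  qed
  have b: "norm (integrand \<sigma> lc L N (a + of_real r * cis 0) * cis 0) \<le>
      (2 * ?\<eta> powr (-1/2) * exp (- (N * ?I))) * exp (- (1 * r))" if r: "0 \<le> r" for r
  proof -
    let ?z = "a + of_real r"
    have "norm ?z \<le> 1/16 + r" using norm_triangle_ineq[of a "of_real r"] na r by simp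
    then have "1 + norm ?z \<le> 2 * exp r" using exp_ge_add_one_self[of r] r by linarith
    moreover have "norm (gfun \<sigma> lc ?z) \<le> ?\<eta> powr (-1/2) * (1 + norm ?z)"
      by (rule norm_gfun_le[OF \<sigma> lc]) (use a a0 r in auto)
    ultimately have g: "norm (gfun \<sigma> lc ?z) \<le> ?\<eta> powr (-1/2) * (2 * exp r)"
      by (smt (verit) mult_left_mono powr_ge_zero)
    have "?I + arctan ?\<eta> * r \<le> Im (phase lc L ?z)"
      by (rule phase_horizontal[OF lc(1) _ _ _ r]) (use a a0 in auto)
    then have "N * (?I + arctan ?\<eta> * r) \<le> N * Im (phase lc L ?z)" using N0 by simp
    moreover have "2 * r \<le> N * arctan ?\<eta> * r" using N r by (intro mult_right_mono) auto
    ultimately have "- (N * Im (phase lc L ?z)) \<le> - (N * ?I) - 2 * r" by (simp add: distrib_left mult.assoc)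
    then have "exp (- (N * Im (phase lc L ?z))) \<le> exp (- (N * ?I) - 2 * r)" by simp
    then have "norm (integrand \<sigma> lc L N ?z) \<le> (?\<eta> powr (-1/2) * (2 * exp r)) * exp (- (N * ?I) - 2 * r)"
      unfolding norm_integrand by (intro mult_mono g) auto
    also have "\<dots> = 2 * ?\<eta> powr (-1/2) * (exp r * exp (- (N * ?I) - 2 * r))" by simp
    also have "\<dots> = 2 * ?\<eta> powr (-1/2) * (exp (- (N * ?I)) * exp (- (1 * r)))"
      unfolding exp_add[symmetric] by (simp add: algebra_simps)
    finally show ?thesis by (simp only: cis_zero mult_1_right mult.assoc)
  qed
  have "norm (ray_integral (integrand \<sigma> lc L N) a 0) \<le>
      (2 * ?\<eta> powr (-1/2) * exp (- (N * ?I))) * exp (- (1 * 0)) / 1"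
    unfolding ray_integral_def by (rule exp_dominated_integral[OF c b]) auto
  also have "\<dots> = 2 * ?\<eta> powr (-1/2) * exp (- (N * ?I))" by simp
  also have "\<dots> \<le> 2 * ?\<eta> powr (-1/2) * (64 * near_const / (sqrt N * k))"
  proof (intro mult_left_mono)
    let ?E = "exp (- (N * (L * (1/16) * (sqrt 2 / 2) + (1/16)\<^sup>2 / 4)))"
    have "exp (- (N * ?I)) \<le> ?E"
      using Im_phase_diagonal_ge[OF lc, of "1/16" L] N0 unfolding a_def by simp
    also have "\<dots> \<le> (4 * (4 * (1/16) + 4 * N * (1/16) ^ 3)) * ?E"
    proof -
      have "1 \<le> 4 * (4 * (1/16) + 4 * N * (1/16) ^ 3)" using N0 by simp
      then have "1 * ?E \<le> (4 * (4 * (1/16) + 4 * N * (1/16) ^ 3)) * ?E"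
        by (intro mult_right_mono) auto
      then show ?thesis by simp
    qed
    also have "\<dots> \<le> 4 * (112 * exp 4 / sqrt N * exp (- (k * (1/16))))"
      using mult_left_mono[OF cubic_gaussian_scaled_le[OF N0, of "1/16" L], of 4]
      unfolding k_def by (simp only: mult.assoc; simp?)
    \<comment> \<open>The exponentially small factor is reduced to \<open>16 / k\<close>, enough to
      match the form of the other errors.\<close>
    also have "\<dots> \<le> 4 * (112 * exp 4 / sqrt N * (16 / k))"
      using mult_exp_le[OF k, of "1/16"] N0 by (intro mult_left_mono) auto
    also have "\<dots> = 64 * near_const / (sqrt N * k)" by (simp add: near_const_def)
    finally show "exp (- (N * ?I)) \<le> 64 * near_const / (sqrt N * k)" .
  qed auto
  finally show ?thesis unfolding a_def by simp
qed

lemma ray_integral_error: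
  assumes \<sigma>: "1/2 \<le> \<sigma>" "\<sigma> < 1" and lc: "0 < lc" "lc \<le> 1" and L: "0 \<le> L"
    and N: "2 \<le> N * arctan (sqrt 2 / 32)"
    and \<phi>: "0 < \<phi>" "\<phi> < pi / 2" and adm: "0 < sin \<phi> * (L + ln lc) + pi * cos \<phi>"
  shows "norm (ray_integral (integrand \<sigma> lc L N) 0 \<phi> - ray_integral (model lc L N) 0 (pi/4)) \<le>
    err_const / (sqrt N * (sqrt N + N * L * (sqrt 2 / 2)))"
proof -
  let ?k = "sqrt N + N * L * (sqrt 2 / 2)"
  let ?e = "\<lambda>r. model lc L N (of_real r * cis (pi/4)) * cis (pi/4)"
  let ?f = "\<lambda>r. integrand \<sigma> lc L N (of_real r * cis (pi/4)) * cis (pi/4)"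
  have "0 < arctan (sqrt 2 / 32)" by simp
  then have N0: "0 < N" using N by (smt (verit) mult_nonpos_nonneg)
  note near = near_difference[OF \<sigma> lc N0 L]
  note tail = model_tail[OF lc(1) N0 L]
  note far = far_integral[OF \<sigma> lc L N]
  have "(?e has_integral integral {0..1/16} ?e + integral {1/16..} ?e) ({0..1/16} \<union> {1/16..})"
    by (rule has_integral_Un[OF integrable_integral[OF near(1)] integrable_integral[OF tail(1)]])
      (rule negligible_subset[of "{1/16}"], auto)
  moreover have "{0..1/16} \<union> {1/16..} = {0::real..}" by auto
  ultimately have m: "ray_integral (model lc L N) 0 (pi/4) = integral {0..1/16} ?e + integral {1/16..} ?e"
    unfolding ray_integral_def add_0 by (simp only: integral_unique)
  have d: "ray_integral (integrand \<sigma> lc L N) 0 \<phi> =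
    integral {0..1/16} ?f + ray_integral (integrand \<sigma> lc L N) (of_real (1/16) * cis (pi/4)) 0"
    by (rule ray_integral_deform[OF \<sigma> lc N0 \<phi> _ adm]) simp
  have "ray_integral (integrand \<sigma> lc L N) 0 \<phi> - ray_integral (model lc L N) 0 (pi/4) =
    (integral {0..1/16} ?f - integral {0..1/16} ?e) +
    (ray_integral (integrand \<sigma> lc L N) (of_real (1/16) * cis (pi/4)) 0 - integral {1/16..} ?e)"
    unfolding d m by (rule add_diff_add)
  then have "norm (ray_integral (integrand \<sigma> lc L N) 0 \<phi> - ray_integral (model lc L N) 0 (pi/4)) \<le>
    norm (integral {0..1/16} ?f - integral {0..1/16} ?e) +
    (norm (ray_integral (integrand \<sigma> lc L N) (of_real (1/16) * cis (pi/4)) 0) + norm (integral {1/16..} ?e))"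
    by (simp only:) (intro norm_triangle_le add_left_mono norm_triangle_ineq4)
  also have "\<dots> \<le> near_const / (sqrt N * ?k) +
     (128 * (sqrt 2 / 32) powr (-1/2) * near_const / (sqrt N * ?k) + 4 * near_const / (sqrt N * ?k))"
    by (intro add_mono near(2) tail(2) far)
  also have "\<dots> = err_const / (sqrt N * ?k)"
    unfolding err_const_def by (simp add: algebra_simps add_divide_distrib)
  finally show ?thesis .
qed

text \<open>On the diagonal the quadratic part of the exponent is the real number
  \<open>- N * (1 + lc) / 2 * r\<^sup>2\<close>. Rescaling by \<open>s\<close> normalises this
  Gaussian and leaves the linear term as the rate of \<open>gexp\<close>.\<close>

lemma ray_integral_model:
  assumes lc: "0 < lc" and N: "0 < N"
  defines "s \<equiv> sqrt (N * (1 + lc) / 2)"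
  shows "ray_integral (model lc L N) 0 (pi/4) =
    cis (pi/4) * gint ((1 - \<i>) * of_real (N * L * (sqrt 2 / 2) / s)) / of_real s"
proof -
  have s: "0 < s" "s\<^sup>2 = N * (1 + lc) / 2" using N lc by (auto simp: s_def)
  let ?\<beta> = "(1 - \<i>) * of_real (N * L * (sqrt 2 / 2) / s)"
  have c: "cis (pi / 4) = (1 + \<i>) * of_real (sqrt 2 / 2)"
    by (auto simp: complex_eq_iff cos_45 sin_45)
  have m: "model lc L N (0 + of_real r * cis (pi/4)) = gexp ?\<beta> (s * r)" for r
  proof -
    have 1: "?\<beta> * of_real (s * r) = (1 - \<i>) * of_real (N * L * (sqrt 2 / 2) * r)"
      using s by simp
    have 2: "(s * r)\<^sup>2 = N * (1 + lc) / 2 * r\<^sup>2" by (simp only: power_mult_distrib s)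
    have "\<i> * of_real N * (of_real L * (of_real r * cis (pi/4)) + of_real ((1 + lc) / 2) * (\<i> * of_real (r\<^sup>2))) =
       - of_real (N * (1 + lc) / 2 * r\<^sup>2) - (1 - \<i>) * of_real (N * L * (sqrt 2 / 2) * r)"
      unfolding c by (simp add: complex_eq_iff field_simps)
    then show ?thesis unfolding model_def gexp_def add_0 diagonal(3) 1 2 by (simp only:)
  qed
  show ?thesis
    unfolding ray_integral_def m gint_def integral_mult_left integral_stretch_half_line[OF s(1)]
    by (simp only: scaleR_conv_of_real of_real_inverse divide_inverse mult_ac)
qed

text \<open>Here \<open>s * b\<close> is exactly the linear damping
  \<open>N * L * sqrt 2 / 2\<close>, and \<open>s \<le> sqrt N\<close> because
  \<open>lc \<le> 1\<close>. Hence the error has at least the factor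
  \<open>1 / (s * (1 + b))\<close>, which is also the size of the lower bound for the model
  integral; the quotient is of order \<open>1 / sqrt N\<close> whatever \<open>L\<close> is.\<close>

lemma ray_integral_relative_error:
  assumes \<sigma>: "1/2 \<le> \<sigma>" "\<sigma> < 1" and lc: "0 < lc" "lc \<le> 1" and L: "0 \<le> L"
    and N: "2 \<le> N * arctan (sqrt 2 / 32)"
    and \<phi>: "0 < \<phi>" "\<phi> < pi / 2" and adm: "0 < sin \<phi> * (L + ln lc) + pi * cos \<phi>"
  shows "norm (ray_integral (integrand \<sigma> lc L N) 0 \<phi> - ray_integral (model lc L N) 0 (pi/4)) \<le>
    err_const * sqrt 2 * exp 2 / sqrt N * norm (ray_integral (model lc L N) 0 (pi/4))"
    and "ray_integral (model lc L N) 0 (pi/4) \<noteq> 0"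
proof -
  have "0 < arctan (sqrt 2 / 32)" by simp
  then have N0: "0 < N" using N by (smt (verit) mult_nonpos_nonneg)
  define s where "s = sqrt (N * (1 + lc) / 2)"
  define b where "b = N * L * (sqrt 2 / 2) / s"
  have s: "0 < s" using N0 lc by (auto simp: s_def)
  have b: "0 \<le> b" using N0 L s by (simp add: b_def)
  have "N * (1 + lc) / 2 \<le> N" using N0 lc mult_left_mono[of lc 1 N] by (simp add: distrib_left)
  then have sN: "s \<le> sqrt N" unfolding s_def by (rule real_sqrt_le_mono)
  have k: "s * (1 + b) \<le> sqrt N + N * L * (sqrt 2 / 2)"
    using sN s by (simp add: b_def distrib_left)
  have G: "norm (ray_integral (model lc L N) 0 (pi/4)) = norm (gint ((1 - \<i>) * of_real b)) / s"
    using s unfolding ray_integral_model[OF lc(1) N0] s_def[symmetric] b_def[symmetric]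
    by (simp add: norm_mult norm_divide)
  have "exp (-2) / (1 + b) / sqrt 2 \<le> rint b / sqrt 2" by (intro divide_right_mono rint_ge b) simp
  also have "\<dots> \<le> norm (gint ((1 - \<i>) * of_real b))" by (rule norm_gint_ge[OF b])
  finally have low: "exp (-2) / (1 + b) / sqrt 2 / s \<le> norm (ray_integral (model lc L N) 0 (pi/4))"
    unfolding G using s by (intro divide_right_mono) auto
  moreover have "0 < exp (-2) / (1 + b) / sqrt 2 / s" using b s by simp
  ultimately show "ray_integral (model lc L N) 0 (pi/4) \<noteq> 0" by (metis norm_zero not_le)
  have "0 < s * (1 + b)" using s b by simp
  then have "err_const / (sqrt N * (sqrt N + N * L * (sqrt 2 / 2))) \<le> err_const / (sqrt N * (s * (1 + b)))"
    by (intro frac_le mult_left_mono k) (use const_pos N0 in \<open>auto intro: less_imp_le\<close>)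
  also have "\<dots> = err_const * sqrt 2 * exp 2 / sqrt N * (exp (-2) / (1 + b) / sqrt 2 / s)"
  proof -
    have "exp 2 * exp (-2) = (1::real)" by (simp flip: exp_add)
    moreover have "err_const * sqrt 2 * exp 2 / sqrt N * (exp (-2) / (1 + b) / sqrt 2 / s) =
        (exp 2 * exp (-2)) * (err_const / (sqrt N * (s * (1 + b))))"
      by (simp add: mult_ac)
    ultimately show ?thesis by simp
  qed
  also have "\<dots> \<le> err_const * sqrt 2 * exp 2 / sqrt N * norm (ray_integral (model lc L N) 0 (pi/4))"
    using const_pos N0 by (intro mult_left_mono low) auto
  finally show "norm (ray_integral (integrand \<sigma> lc L N) 0 \<phi> - ray_integral (model lc L N) 0 (pi/4)) \<le>
    err_const * sqrt 2 * exp 2 / sqrt N * norm (ray_integral (model lc L N) 0 (pi/4))"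
    using ray_integral_error[OF \<sigma> lc L N \<phi> adm] by linarith
qed

section \<open>The integrals of the theorem\<close>

text \<open>Translates the bound on the angle into the growth condition of
  \<open>phase_ray_growth\<close>: for negative \<open>ln \<lambda>\<close> it is
  \<open>tan \<phi> < pi / |ln \<lambda>|\<close> with denominators cleared.\<close>

lemma admD:
  assumes adm: "adm_phi (lc * (1 + \<Lambda>)) \<phi>" and lc: "0 < lc" and \<Lambda>: "0 \<le> \<Lambda>"
  shows "0 < \<phi>" "\<phi> < pi / 2" "0 < sin \<phi> * (ln (1 + \<Lambda>) + ln lc) + pi * cos \<phi>"
proof -
  let ?l = "ln (lc * (1 + \<Lambda>))"
  have l: "?l = ln (1 + \<Lambda>) + ln lc" using lc \<Lambda> by (simp add: ln_mult)
  show p: "0 < \<phi>" using adm by (simp add: adm_phi_def)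
  show q: "\<phi> < pi / 2"
    using adm arctan_ubound[of "pi / \<bar>?l\<bar>"] by (auto simp: adm_phi_def split: if_splits)
  have sc: "0 < sin \<phi>" "0 < cos \<phi>" using p q by (auto simp: sin_gt_zero cos_gt_zero)
  show "0 < sin \<phi> * (ln (1 + \<Lambda>) + ln lc) + pi * cos \<phi>"
  proof (cases "0 \<le> ?l")
    case True
    then show ?thesis unfolding l[symmetric] using sc by (intro add_nonneg_pos) auto
  next
    case False
    then have "\<phi> < arctan (pi / \<bar>?l\<bar>)" using adm by (simp add: adm_phi_def)
    then have "tan \<phi> < tan (arctan (pi / \<bar>?l\<bar>))"
      using p pi_gt_zero arctan_ubound by (intro tan_monotone) linarith+
    moreover have "\<bar>?l\<bar> = - ?l" using False by linarith
    ultimately have "tan \<phi> < pi / - ?l" by (simp only: tan_arctan)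
    then have "sin \<phi> / cos \<phi> < pi / - ?l" by (simp only: tan_def)
    moreover have "0 < - ?l" using False by linarith
    moreover have "s * m < pi * c" if "s / c < pi / m" "0 < m" "0 < c" for s c m :: real
      using that by (simp add: field_simps)
    ultimately have "sin \<phi> * - ?l < pi * cos \<phi>" using sc by blast
    then show ?thesis unfolding l[symmetric] by simp
  qed
qed

section \<open>The substitution between the two integrals\<close>

lemma lamc_pos:
  assumes "1 < t" "\<delta> < 1"
  shows "0 < lamc \<delta> t"
proof -
  have "1 < t powr (1 - \<delta>)" using assms by (intro gr_one_powr) auto
  then show ?thesis by (simp add: lamc_def)
qed

text \<open>Consequently \<open>1 / (1 + lc) = 1 - t powr (\<delta> - 1)\<close>, so the starting
  point of \<open>J_B\<close> corresponds to \<open>\<zeta> = 0\<close>; it also gives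
  \<open>N = t powr \<delta>\<close>.\<close>

lemma lamc_ratio:
  assumes "1 < t" "\<delta> < 1"
  shows "lamc \<delta> t / (1 + lamc \<delta> t) = t powr (\<delta> - 1)"
proof -
  have "1 < t powr (1 - \<delta>)" using assms by (intro gr_one_powr) auto
  moreover have "t powr (\<delta> - 1) = 1 / t powr (1 - \<delta>)"
    using powr_minus_divide[of t "1 - \<delta>"] by simp
  ultimately show ?thesis by (simp add: lamc_def field_simps)
qed

lemma powr_of_real_mult:
  assumes "0 < p" "w \<noteq> 0"
  shows "(of_real p * w) powr (of_real s) = of_real (p powr s) * (w powr of_real s :: complex)"
proof -
  have "Ln (of_real p * w) = of_real (ln p) + Ln w"
    using Ln_times_of_real[OF assms] assms by (simp add: Ln_of_real)
  then show ?thesis using assms unfolding powr_def by (simp add: distrib_left exp_add flip: exp_of_real)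
qed

lemma integrand_eq_Jt_B_integrand:
  assumes lc: "0 < lc"
  shows "gfun \<sigma> lc \<zeta> * exp (\<i> * of_real t * hfun lc \<Lambda> \<zeta>) =
    integrand \<sigma> lc (ln (1 + \<Lambda>)) (t * lc / (1 + lc)) \<zeta>"
proof -
  have "f1 lc \<Lambda> \<zeta> = of_real lc * phase lc (ln (1 + \<Lambda>)) \<zeta>"
    using lc by (simp add: f1_def phase_def field_simps)
  then have "\<i> * of_real t * hfun lc \<Lambda> \<zeta> = \<i> * of_real (t * lc / (1 + lc)) * phase lc (ln (1 + \<Lambda>)) \<zeta>"
    by (simp add: hfun_def)
  then show ?thesis by (simp add: integrand_def)
qed

text \<open>Both \<open>z\<close> and \<open>1 - z\<close> are positive real multiples of the new
  quantities, so the logarithms split without multiples of \<open>2 * pi * \<i>\<close>. The real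
  constants that split off make up \<open>f0\<close>.\<close>

lemma Ffun_subst:
  assumes lc: "0 < lc" and \<Lambda>: "0 \<le> \<Lambda>" and \<zeta>: "1 - \<zeta> \<noteq> 0" "1 + of_real lc * \<zeta> \<noteq> 0"
  defines "z \<equiv> (1 + of_real lc * \<zeta>) / of_real (1 + lc)"
  shows "Ffun (lc * (1 + \<Lambda>)) z = of_real (f0 \<Lambda> lc / (1 + lc)) + hfun lc \<Lambda> \<zeta>"
    "1 - z = of_real (lc / (1 + lc)) * (1 - \<zeta>)" "z = of_real (1 / (1 + lc)) * (1 + of_real lc * \<zeta>)"
proof -
  have n: "of_real (1 + lc) \<noteq> (0::complex)" using lc by (simp only: of_real_eq_0_iff)
  show z1: "1 - z = of_real (lc / (1 + lc)) * (1 - \<zeta>)"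
    using n unfolding z_def by (simp add: field_simps)
  show z2: "z = of_real (1 / (1 + lc)) * (1 + of_real lc * \<zeta>)" unfolding z_def by simp
  have L1: "Ln (1 - z) = of_real (ln lc - ln (1 + lc)) + Ln (1 - \<zeta>)"
    unfolding z1 using Ln_times_of_real[of "lc / (1 + lc)", OF _ \<zeta>(1)] lc
    by (simp add: Ln_of_real ln_div del: of_real_divide)
  have L2: "Ln z = - of_real (ln (1 + lc)) + Ln (1 + of_real lc * \<zeta>)"
    unfolding z2 using Ln_times_of_real[of "1 / (1 + lc)", OF _ \<zeta>(2)] lc
    by (simp add: Ln_of_real ln_div del: of_real_divide)
  have l: "ln (lc * (1 + \<Lambda>)) = ln lc + ln (1 + \<Lambda>)" using lc \<Lambda> by (simp add: ln_mult)
  have f: "f0 \<Lambda> lc = ln lc + ln (1 + \<Lambda>) - ln (1 + lc) - lc * (ln (1 + lc) - ln lc)"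
    using lc \<Lambda> by (simp add: f0_def ln_div ln_mult)
  have "of_real (1 + lc) * Ffun (lc * (1 + \<Lambda>)) z = of_real (f0 \<Lambda> lc) + f1 lc \<Lambda> \<zeta>"
  proof -
    have a: "of_real (1 + lc) * (1 - z) = of_real lc * (1 - \<zeta>)" using n unfolding z_def by (simp add: field_simps)
    have b: "of_real (1 + lc) * z = 1 + of_real lc * \<zeta>" using n unfolding z_def by simp
    have "of_real (1 + lc) * Ffun (lc * (1 + \<Lambda>)) z =
      (of_real (1 + lc) * (1 - z)) * Ln (1 - z) + (of_real (1 + lc) * z) * Ln z +
      (of_real (1 + lc) * z) * of_real (ln (lc * (1 + \<Lambda>)))"
      by (simp only: Ffun_def distrib_left mult.assoc)
    also have "\<dots> = of_real (f0 \<Lambda> lc) + f1 lc \<Lambda> \<zeta>"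
      unfolding a b L1 L2 l f f1_def by (simp add: algebra_simps)
    finally show ?thesis .
  qed
  then have "Ffun (lc * (1 + \<Lambda>)) z = (of_real (f0 \<Lambda> lc) + f1 lc \<Lambda> \<zeta>) / of_real (1 + lc)"
    by (simp only: nonzero_eq_divide_eq[OF n] mult.commute)
  then show "Ffun (lc * (1 + \<Lambda>)) z = of_real (f0 \<Lambda> lc / (1 + lc)) + hfun lc \<Lambda> \<zeta>"
    by (simp only: hfun_def of_real_divide add_divide_distrib)
qed

text \<open>The substitution is affine with positive slope \<open>p = lc / (1 + lc)\<close>, so it
  carries the ray to a ray of the same direction.\<close>

lemma J_B_eq:
  assumes t: "1 < t" and \<delta>: "\<delta> < 1" and \<Lambda>: "0 \<le> \<Lambda>" and \<phi>: "0 < \<phi>" "\<phi> < pi / 2"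
  shows "J_B \<sigma> \<delta> t (lamc \<delta> t * (1 + \<Lambda>)) \<phi> =
          of_real ((lamc \<delta> t / (1 + lamc \<delta> t)) powr (1/2) * (1 / (1 + lamc \<delta> t)) powr (\<sigma> - 1/2))
          * exp (\<i> * of_real (t * f0 \<Lambda> (lamc \<delta> t) / (1 + lamc \<delta> t)))
          * Jt_B \<sigma> \<delta> t \<Lambda> \<phi>"
proof -
  define lc where "lc = lamc \<delta> t"
  have lc: "0 < lc" unfolding lc_def by (rule lamc_pos[OF t \<delta>])
  define p where "p = lc / (1 + lc)"
  have p: "0 < p" using lc by (simp add: p_def)
  define K where "K = of_real (p powr (-1/2) * (1 / (1 + lc)) powr (\<sigma> - 1/2)) * exp (\<i> * of_real (t * f0 \<Lambda> lc / (1 + lc)))"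
  let ?g = "\<lambda>\<zeta>. gfun \<sigma> lc \<zeta> * exp (\<i> * of_real t * hfun lc \<Lambda> \<zeta>)"
  let ?j = "\<lambda>z. (1 - z) powr (-1/2) * z powr (of_real (\<sigma> - 1/2)) * exp (\<i> * of_real t * Ffun (lc * (1 + \<Lambda>)) z)"
  have c: "of_real (1 - t powr (\<delta> - 1)) = (1 / of_real (1 + lc) :: complex)"
  proof -
    have "1 - t powr (\<delta> - 1) = 1 / (1 + lc)"
      using lamc_ratio[OF t \<delta>] lc unfolding lc_def[symmetric] by (simp add: field_simps)
    then show ?thesis by simp
  qed
  have j: "?j (1 / of_real (1 + lc) + of_real r * cis \<phi>) = K * ?g (of_real (r / p) * cis \<phi>)" if r: "0 \<le> r" for r
  proof -
    let ?\<zeta> = "of_real (r / p) * cis \<phi>"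
    have "?\<zeta> \<in> slit lc" by (rule ray_in_slit[OF lc \<phi>]) (use r p in simp)
    then have n: "1 - ?\<zeta> \<noteq> 0" "1 + of_real lc * ?\<zeta> \<noteq> 0" by (auto simp: slit_def)
    have z: "1 / of_real (1 + lc) + of_real r * cis \<phi> = (1 + of_real lc * ?\<zeta>) / of_real (1 + lc)"
    proof -
      have "r = lc * (r / p) / (1 + lc)"
      proof -
        have "1 + lc \<noteq> 0" using lc by linarith
        then show ?thesis using lc by (simp add: p_def)
      qed
      then have "of_real r = of_real lc * of_real (r / p) / (of_real (1 + lc) :: complex)"
        by (metis of_real_divide of_real_mult)
      then show ?thesis
        by (subst \<open>of_real r = _\<close>) (simp only: add_divide_distrib times_divide_eq_left mult.assoc)
    qed
    note s = Ffun_subst[OF lc \<Lambda> n]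
    have m: "(-1/2 :: complex) = of_real (-1/2)" by simp
    have e: "exp (\<i> * of_real t * (of_real (f0 \<Lambda> lc / (1 + lc)) + hfun lc \<Lambda> ?\<zeta>)) =
      exp (\<i> * of_real (t * f0 \<Lambda> lc / (1 + lc))) * exp (\<i> * of_real t * hfun lc \<Lambda> ?\<zeta>)"
      unfolding exp_add[symmetric] by (simp add: distrib_left mult.assoc)
    have 1: "(1 - (1 + of_real lc * ?\<zeta>) / of_real (1 + lc)) powr (-1/2) = of_real (p powr (-1/2)) * (1 - ?\<zeta>) powr (-1/2)"
      unfolding s(2) m p_def[symmetric] by (rule powr_of_real_mult[OF p n(1)])
    have 2: "((1 + of_real lc * ?\<zeta>) / of_real (1 + lc)) powr (of_real (\<sigma> - 1/2)) =
      of_real ((1 / (1 + lc)) powr (\<sigma> - 1/2)) * (1 + of_real lc * ?\<zeta>) powr (of_real (\<sigma> - 1/2))"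
      by (subst s(3), rule powr_of_real_mult[OF _ n(2)]) (use lc in simp)
    show ?thesis unfolding z 1 2 s(1) e K_def gfun_def by (simp only: of_real_mult mult_ac)
  qed
  have "J_B \<sigma> \<delta> t (lc * (1 + \<Lambda>)) \<phi> = integral {0..} (\<lambda>r. K * (?g (of_real (inverse p * r) * cis \<phi>) * cis \<phi>))"
    unfolding J_B_def ray_integral_def c
  proof (rule integral_cong)
    fix r :: real assume "r \<in> {0..}"
    then have "?j (1 / of_real (1 + lc) + of_real r * cis \<phi>) * cis \<phi> = K * ?g (of_real (r / p) * cis \<phi>) * cis \<phi>"
      using j by (simp only: atLeast_iff)
    then show "?j (1 / of_real (1 + lc) + of_real r * cis \<phi>) * cis \<phi> = K * (?g (of_real (inverse p * r) * cis \<phi>) * cis \<phi>)"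
      by (simp only: divide_inverse mult_ac)
  qed
  also have "\<dots> = K * integral {0..} (\<lambda>r. ?g (of_real (inverse p * r) * cis \<phi>) * cis \<phi>)"
    by (rule integral_mult_right)
  also have "integral {0..} (\<lambda>r. ?g (of_real (inverse p * r) * cis \<phi>) * cis \<phi>) = of_real p * Jt_B \<sigma> \<delta> t \<Lambda> \<phi>"
    using integral_stretch_half_line[of "inverse p" "\<lambda>r. ?g (of_real r * cis \<phi>) * cis \<phi>"] p
    unfolding Jt_B_def ray_integral_def lc_def[symmetric] add_0
    by (simp only: inverse_inverse_eq scaleR_conv_of_real positive_imp_inverse_positive)
  also have "K * (of_real p * Jt_B \<sigma> \<delta> t \<Lambda> \<phi>) =
     of_real (p powr (1/2) * (1 / (1 + lc)) powr (\<sigma> - 1/2)) * exp (\<i> * of_real (t * f0 \<Lambda> lc / (1 + lc))) * Jt_B \<sigma> \<delta> t \<Lambda> \<phi>"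
  proof -
    \<comment> \<open>The amplitude contributes the power \<open>-1/2\<close> and the Jacobian one
      further factor \<open>p\<close>.\<close>
    have "p powr (1/2) = p powr (-1/2) * p"
      using powr_add[of p "-1/2" 1] p by simp
    then show ?thesis unfolding K_def by (simp only: of_real_mult mult_ac)
  qed
  finally show ?thesis unfolding p_def lc_def .
qed

section \<open>The main term and its expansion\<close>

definition main_term :: "real \<Rightarrow> real \<Rightarrow> real \<Rightarrow> complex" where
  "main_term \<delta> t \<Lambda> = exp (- \<i> * of_real ((omega \<delta> t \<Lambda>)\<^sup>2))
      * of_real (sqrt (2 / (lamc \<delta> t * t))) * fres (omega \<delta> t \<Lambda>)"

lemma main_term_eq:
  "main_term \<delta> t \<Lambda> = of_real (sqrt (2 / (lamc \<delta> t * t))) *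
     (cis (pi / 4) * gint ((1 - \<i>) * of_real (sqrt 2 * omega \<delta> t \<Lambda>)))"
proof -
  have "exp (- \<i> * of_real ((omega \<delta> t \<Lambda>)\<^sup>2)) * exp (\<i> * of_real ((omega \<delta> t \<Lambda>)\<^sup>2)) = 1"
    unfolding exp_add[symmetric] by simp
  then show ?thesis unfolding main_term_def fres_eq_gint by (simp add: mult_ac)
qed

text \<open>Since \<open>N * (1 + lc) / 2 = lc * t / 2\<close>, the scaling factor of the model is
  the reciprocal of \<open>sqrt (2 / (lc * t))\<close>, and the rate left after normalising the
  Gaussian is \<open>sqrt 2 * omega\<close>. This is the origin of \<open>omega\<close>.\<close>

lemma main_term_eq_ray_integral:
  assumes lc: "0 < lamc \<delta> t" and t: "0 < t"
  shows "main_term \<delta> t \<Lambda> =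
    ray_integral (model (lamc \<delta> t) (ln (1 + \<Lambda>)) (t * lamc \<delta> t / (1 + lamc \<delta> t))) 0 (pi/4)"
proof -
  define lc where "lc = lamc \<delta> t"
  define L where "L = ln (1 + \<Lambda>)"
  define s where "s = sqrt (lc * t / 2)"
  have lc: "0 < lc" using assms by (simp add: lc_def)
  have s: "0 < s" "s * s = lc * t / 2" using lc t by (auto simp: s_def)
  have N: "t * lc / (1 + lc) * (1 + lc) / 2 = lc * t / 2" using lc by (simp add: field_simps)
  have si: "sqrt (2 / (lc * t)) = 1 / s" unfolding s_def real_sqrt_divide by simp
  have b: "t * lc / (1 + lc) * L * (sqrt 2 / 2) / s = sqrt 2 * omega \<delta> t \<Lambda>"
  proof -
    have "t * lc / (1 + lc) * L * (sqrt 2 / 2) / s = (s * s) * L * sqrt 2 / (1 + lc) / s"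
      unfolding s(2) by (simp add: field_simps)
    also have "\<dots> = sqrt 2 * (s * L / (1 + lc))" using s by simp
    finally show ?thesis by (simp add: omega_def s_def lc_def L_def)
  qed
  have "ray_integral (model lc L (t * lc / (1 + lc))) 0 (pi/4) =
     cis (pi / 4) * gint ((1 - \<i>) * of_real (sqrt 2 * omega \<delta> t \<Lambda>)) / of_real s"
    using ray_integral_model[OF lc, of "t * lc / (1 + lc)" L] lc t
    unfolding N s_def[symmetric] b by simp
  then show ?thesis unfolding main_term_eq lc_def[symmetric] L_def[symmetric] si by simp
qed

lemma Jt_B_asymp:
  assumes \<delta>: "0 < \<delta>" "\<delta> < 1" and \<sigma>: "1/2 \<le> \<sigma>" "\<sigma> < 1" and e: "0 < e"
  shows "\<exists>T>1. \<forall>t\<ge>T. \<forall>\<Lambda> \<phi>. 0 \<le> \<Lambda> \<longrightarrow> adm_phi (lamc \<delta> t * (1 + \<Lambda>)) \<phi> \<longrightarrow>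
    (\<exists>\<eta>. norm \<eta> \<le> e \<and> Jt_B \<sigma> \<delta> t \<Lambda> \<phi> = main_term \<delta> t \<Lambda> * (1 + \<eta>))"
proof -
  let ?C = "err_const * sqrt 2 * exp 2"
  have "filterlim (\<lambda>t. t powr \<delta>) at_top at_top" "filterlim (\<lambda>t. t powr (1 - \<delta>)) at_top at_top"
    using \<delta> by real_asymp+
  \<comment> \<open>The thresholds secure, in this order, decay rate 2 on the horizontal half-line,
    a relative error of at most \<open>e\<close>, and \<open>lamc \<delta> t \<le> 1\<close>. They
    involve neither \<open>\<Lambda>\<close> nor \<open>\<phi>\<close>.\<close>
  then have "\<forall>\<^sub>F t in at_top. 2 / arctan (sqrt 2 / 32) \<le> t powr \<delta>"
    "\<forall>\<^sub>F t in at_top. (?C / e)\<^sup>2 \<le> t powr \<delta>" "\<forall>\<^sub>F t in at_top. 2 \<le> t powr (1 - \<delta>)"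
    unfolding filterlim_at_top by blast+
  then have "\<forall>\<^sub>F t in at_top. 2 / arctan (sqrt 2 / 32) \<le> t powr \<delta> \<and> (?C / e)\<^sup>2 \<le> t powr \<delta> \<and>
      2 \<le> t powr (1 - \<delta>)"
    by eventually_elim simp
  then obtain T where T: "\<And>t. T \<le> t \<Longrightarrow> 2 / arctan (sqrt 2 / 32) \<le> t powr \<delta> \<and> (?C / e)\<^sup>2 \<le> t powr \<delta> \<and>
      2 \<le> t powr (1 - \<delta>)"
    unfolding eventually_at_top_linorder by blast
  have main: "\<exists>\<eta>. norm \<eta> \<le> e \<and> Jt_B \<sigma> \<delta> t \<Lambda> \<phi> = main_term \<delta> t \<Lambda> * (1 + \<eta>)"
    if t: "max T 2 \<le> t" and \<Lambda>: "0 \<le> \<Lambda>" and adm: "adm_phi (lamc \<delta> t * (1 + \<Lambda>)) \<phi>" for t \<Lambda> \<phi>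
  proof -
    have t1: "1 < t" "T \<le> t" using t by auto
    define lc where "lc = lamc \<delta> t"
    define N where "N = t * lc / (1 + lc)"
    have lc: "0 < lc" unfolding lc_def by (rule lamc_pos[OF t1(1) \<delta>(2)])
    have lc1: "lc \<le> 1" using T[OF t1(2)] by (simp add: lc_def lamc_def)
    have "N = t * (lamc \<delta> t / (1 + lamc \<delta> t))" by (simp add: N_def lc_def)
    also have "\<dots> = t powr 1 * t powr (\<delta> - 1)" using lamc_ratio[OF t1(1) \<delta>(2)] t1 by simp
    also have "\<dots> = t powr (1 + (\<delta> - 1))" by (rule powr_add[symmetric])
    also have "\<dots> = t powr \<delta>" by simp
    finally have N: "N = t powr \<delta>" .
    have N0: "0 < N" unfolding N using t1 by simp
    have "2 / arctan (sqrt 2 / 32) \<le> N" using T[OF t1(2)] N by simp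
    then have N2: "2 \<le> N * arctan (sqrt 2 / 32)" by (subst (asm) pos_divide_le_eq) auto
    have "?C / e \<le> sqrt N" by (rule real_le_rsqrt) (use T[OF t1(2)] N in simp)
    then have Ce: "?C / sqrt N \<le> e" using N0 e by (simp add: field_simps)
    note a = admD[OF adm[folded lc_def] lc \<Lambda>]
    have L: "0 \<le> ln (1 + \<Lambda>)" using \<Lambda> by simp
    let ?G = "main_term \<delta> t \<Lambda>"
    have G: "?G = ray_integral (model lc (ln (1 + \<Lambda>)) N) 0 (pi/4)"
      unfolding lc_def N_def by (rule main_term_eq_ray_integral) (use lc t1 in \<open>auto simp: lc_def\<close>)
    have J: "Jt_B \<sigma> \<delta> t \<Lambda> \<phi> = ray_integral (integrand \<sigma> lc (ln (1 + \<Lambda>)) N) 0 \<phi>"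
      unfolding Jt_B_def lc_def[symmetric] N_def by (simp only: integrand_eq_Jt_B_integrand[OF lc])
    note r = ray_integral_relative_error[OF \<sigma> lc lc1 L N2 a, folded G J]
    show ?thesis
    \<comment> \<open>The witness is the relative error itself, legitimate because the main term
      does not vanish.\<close>
    proof (intro exI[of _ "(Jt_B \<sigma> \<delta> t \<Lambda> \<phi> - ?G) / ?G"] conjI)
      show "Jt_B \<sigma> \<delta> t \<Lambda> \<phi> = ?G * (1 + (Jt_B \<sigma> \<delta> t \<Lambda> \<phi> - ?G) / ?G)"
        using r(2) by (simp add: field_simps)
      have "norm (Jt_B \<sigma> \<delta> t \<Lambda> \<phi> - ?G) \<le> e * norm ?G"
        by (rule order_trans[OF r(1)]) (intro mult_right_mono Ce norm_ge_zero)
      then show "norm ((Jt_B \<sigma> \<delta> t \<Lambda> \<phi> - ?G) / ?G) \<le> e"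
        using r(2) by (simp add: norm_divide divide_le_eq)
    qed
  qed
  show ?thesis by (rule exI[of _ "max T 2"]) (use main in auto)
qed

lemma norm_fres_le: "0 \<le> w \<Longrightarrow> norm (fres w) \<le> exp (1/4)"
  unfolding fres_eq_gint by (simp add: norm_mult norm_gint_le)

lemma omega_nonneg:
  assumes "1 < t" "\<delta> < 1" "0 \<le> \<Lambda>"
  shows "0 \<le> omega \<delta> t \<Lambda>"
  using lamc_pos[OF assms(1,2)] assms by (simp add: omega_def)

text \<open>The leading coefficient is \<open>cis (pi/4) / ((1 - \<i>) * sqrt 2 * \<omega>) = \<i> /
  (2 * \<omega>)\<close>, because \<open>(1 + \<i>) / (1 - \<i>) = \<i>\<close>.\<close>

lemma main_term_large_omega:
  assumes w: "0 < omega \<delta> t \<Lambda>"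
  obtains \<rho> where "norm \<rho> \<le> 8 / (omega \<delta> t \<Lambda>) ^ 3"
    "main_term \<delta> t \<Lambda> = of_real (sqrt (2 / (lamc \<delta> t * t))) * (- 1 / (2 * \<i> * of_real (omega \<delta> t \<Lambda>)) + \<rho>)"
proof -
  let ?w = "omega \<delta> t \<Lambda>"
  let ?b = "sqrt 2 * ?w"
  define d where "d = gint ((1 - \<i>) * of_real ?b) - 1 / ((1 - \<i>) * of_real ?b)"
  have b: "0 < ?b" using w by simp
  have d: "norm d \<le> 8 / ?b ^ 3" unfolding d_def by (rule gint_asymp[OF b])
  show ?thesis
  proof (rule that[of "cis (pi / 4) * d"])
    have "?w \<le> ?b" using w mult_right_mono[of 1 "sqrt 2" ?w] by simp
    then have "?w ^ 3 \<le> ?b ^ 3" using w by (intro power_mono) auto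
    then have "8 / ?b ^ 3 \<le> 8 / ?w ^ 3" using w b by (intro divide_left_mono mult_pos_pos zero_less_power) auto
    then show "norm (cis (pi / 4) * d) \<le> 8 / ?w ^ 3" using d by (simp add: norm_mult)
    have c: "cis (pi / 4) = (1 + \<i>) * of_real (sqrt 2 / 2)"
      by (auto simp: complex_eq_iff cos_45 sin_45)
    have "cis (pi / 4) * (1 / ((1 - \<i>) * of_real ?b)) = (1 + \<i>) / (1 - \<i>) / (2 * of_real ?w)"
    proof -
      have "((1 + \<i>) * (S / 2)) * (1 / (m * (S * W))) = (1 + \<i>) / m / (2 * W)" if "S \<noteq> 0" for S m W
        using that by simp
      from this[of "of_real (sqrt 2)"] show ?thesis unfolding c by (simp only: of_real_mult of_real_divide of_real_numeral) simp
    qed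
    also have "(1 + \<i>) / (1 - \<i>) = \<i>" by (simp add: complex_eq_iff Re_divide Im_divide)
    also have "\<i> / (2 * of_real ?w) = - 1 / (2 * \<i> * of_real ?w)"
    proof -
      have "\<i> * \<i> / (\<i> * (2 * of_real ?w)) = \<i> / (2 * of_real ?w)"
        by (rule mult_divide_mult_cancel_left) simp
      moreover have "\<i> * (2 * of_real ?w) = 2 * \<i> * of_real ?w" by (simp only: mult_ac)
      ultimately show ?thesis by (simp only: i_squared)
    qed
    finally have "cis (pi / 4) * gint ((1 - \<i>) * of_real ?b) = - 1 / (2 * \<i> * of_real ?w) + cis (pi / 4) * d"
      by (simp add: d_def algebra_simps)
    then show "main_term \<delta> t \<Lambda> = of_real (sqrt (2 / (lamc \<delta> t * t))) * (- 1 / (2 * \<i> * of_real ?w) + cis (pi / 4) * d)"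
      unfolding main_term_eq by (simp only:)
  qed
qed

theorem theorem1p3:
  fixes \<delta> \<sigma> :: real
  assumes "0 < \<delta>" "\<delta> < 1" "1/2 \<le> \<sigma>" "\<sigma> < 1"
  shows
    "(\<forall>t \<Lambda> \<phi>. 1 < t \<longrightarrow> 0 \<le> \<Lambda> \<longrightarrow> lamc \<delta> t * (1 + \<Lambda>) \<le> t powr (1 - \<delta>) - 1 \<longrightarrow>
        adm_phi (lamc \<delta> t * (1 + \<Lambda>)) \<phi> \<longrightarrow>
        J_B \<sigma> \<delta> t (lamc \<delta> t * (1 + \<Lambda>)) \<phi> =
          of_real ((lamc \<delta> t / (1 + lamc \<delta> t)) powr (1/2) * (1 / (1 + lamc \<delta> t)) powr (\<sigma> - 1/2))
          * exp (\<i> * of_real (t * f0 \<Lambda> (lamc \<delta> t) / (1 + lamc \<delta> t)))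
          * Jt_B \<sigma> \<delta> t \<Lambda> \<phi>)
   \<and> (\<forall>e>0. \<exists>T. \<forall>t\<ge>T. \<forall>\<Lambda> \<phi>. 0 \<le> \<Lambda> \<longrightarrow> lamc \<delta> t * (1 + \<Lambda>) \<le> t powr (1 - \<delta>) - 1 \<longrightarrow>
        adm_phi (lamc \<delta> t * (1 + \<Lambda>)) \<phi> \<longrightarrow>
        (\<exists>\<eta>. norm \<eta> \<le> e \<and>
           Jt_B \<sigma> \<delta> t \<Lambda> \<phi> = exp (- \<i> * of_real ((omega \<delta> t \<Lambda>)\<^sup>2))
              * of_real (sqrt (2 / (lamc \<delta> t * t))) * fres (omega \<delta> t \<Lambda>) * (1 + \<eta>)))
   \<and> (\<forall>B. \<exists>C. \<forall>t \<Lambda>. 1 < t \<longrightarrow> 0 \<le> \<Lambda> \<longrightarrow> lamc \<delta> t * (1 + \<Lambda>) \<le> t powr (1 - \<delta>) - 1 \<longrightarrow>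
        omega \<delta> t \<Lambda> \<le> B \<longrightarrow> norm (fres (omega \<delta> t \<Lambda>)) \<le> C)
   \<and> (\<exists>C w0. 0 < w0 \<and> (\<forall>e>0. \<exists>T. \<forall>t\<ge>T. \<forall>\<Lambda> \<phi>. 0 \<le> \<Lambda> \<longrightarrow>
        lamc \<delta> t * (1 + \<Lambda>) \<le> t powr (1 - \<delta>) - 1 \<longrightarrow>
        adm_phi (lamc \<delta> t * (1 + \<Lambda>)) \<phi> \<longrightarrow> w0 \<le> omega \<delta> t \<Lambda> \<longrightarrow>
        (\<exists>\<rho> \<eta>. norm \<rho> \<le> C / (omega \<delta> t \<Lambda>) ^ 3 \<and> norm \<eta> \<le> e \<and>
           Jt_B \<sigma> \<delta> t \<Lambda> \<phi> = of_real (sqrt (2 / (lamc \<delta> t * t)))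
              * (- 1 / (2 * \<i> * of_real (omega \<delta> t \<Lambda>)) + \<rho>) * (1 + \<eta>))))"
    (is "?P1 \<and> ?P2 \<and> ?P3 \<and> ?P4")
proof (intro conjI)
  show ?P1 using J_B_eq assms admD lamc_pos by blast
  show ?P2
    unfolding main_term_def[symmetric] using Jt_B_asymp[OF assms] by meson
  show ?P3 using norm_fres_le omega_nonneg assms by blast
  show ?P4
  \<comment> \<open>The 8 is the constant of \<open>gint_asymp\<close>. The expansion is valid for
    every positive \<open>\<omega>\<close>, so 1 is merely a convenient threshold.\<close>
  proof (rule exI[of _ 8], rule exI[of _ 1], intro conjI allI impI)
    fix e :: real assume "0 < e"
    from Jt_B_asymp[OF assms this] obtain T where T: "\<And>t \<Lambda> \<phi>. T \<le> t \<Longrightarrow> 0 \<le> \<Lambda> \<Longrightarrow>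
      adm_phi (lamc \<delta> t * (1 + \<Lambda>)) \<phi> \<Longrightarrow> \<exists>\<eta>. norm \<eta> \<le> e \<and> Jt_B \<sigma> \<delta> t \<Lambda> \<phi> = main_term \<delta> t \<Lambda> * (1 + \<eta>)"
      by blast
    show "\<exists>T. \<forall>t\<ge>T. \<forall>\<Lambda> \<phi>. 0 \<le> \<Lambda> \<longrightarrow>
        lamc \<delta> t * (1 + \<Lambda>) \<le> t powr (1 - \<delta>) - 1 \<longrightarrow>
        adm_phi (lamc \<delta> t * (1 + \<Lambda>)) \<phi> \<longrightarrow> 1 \<le> omega \<delta> t \<Lambda> \<longrightarrow>
        (\<exists>\<rho> \<eta>. norm \<rho> \<le> 8 / (omega \<delta> t \<Lambda>) ^ 3 \<and> norm \<eta> \<le> e \<and>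
           Jt_B \<sigma> \<delta> t \<Lambda> \<phi> = of_real (sqrt (2 / (lamc \<delta> t * t)))
              * (- 1 / (2 * \<i> * of_real (omega \<delta> t \<Lambda>)) + \<rho>) * (1 + \<eta>))"
    proof (rule exI[of _ T], intro allI impI)
      fix t \<Lambda> \<phi> assume a: "T \<le> t" "0 \<le> \<Lambda>" "adm_phi (lamc \<delta> t * (1 + \<Lambda>)) \<phi>" "1 \<le> omega \<delta> t \<Lambda>"
      obtain \<eta> where \<eta>: "norm \<eta> \<le> e" "Jt_B \<sigma> \<delta> t \<Lambda> \<phi> = main_term \<delta> t \<Lambda> * (1 + \<eta>)"
        using T[OF a(1-3)] by blast
      have "0 < omega \<delta> t \<Lambda>" using a(4) by simp
      from main_term_large_omega[OF this] obtain \<rho> where \<rho>: "norm \<rho> \<le> 8 / (omega \<delta> t \<Lambda>) ^ 3"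
        "main_term \<delta> t \<Lambda> = of_real (sqrt (2 / (lamc \<delta> t * t))) * (- 1 / (2 * \<i> * of_real (omega \<delta> t \<Lambda>)) + \<rho>)" .
      show "\<exists>\<rho> \<eta>. norm \<rho> \<le> 8 / (omega \<delta> t \<Lambda>) ^ 3 \<and> norm \<eta> \<le> e \<and>
           Jt_B \<sigma> \<delta> t \<Lambda> \<phi> = of_real (sqrt (2 / (lamc \<delta> t * t)))
              * (- 1 / (2 * \<i> * of_real (omega \<delta> t \<Lambda>)) + \<rho>) * (1 + \<eta>)"
        using \<eta> \<rho> by metis
    qed
  qed simp
qed

end
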